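(* Let $(\pi,V)$ be an infinite-dimensional irreducible admissible representation of $\mathrm{PGSp}_4(F)$. Let $m_1,\dots,m_r\ge0$ be pairwise distinct integers and let $v_i\in V$ be nonzero vectors with $v_i$ invariant under $K_{2m_i}$. Then $v_1,\dots,v_r$ are linearly independent.
   Context: $F$ nonarchimedean of characteristic zero with integers $\mathfrak{o}$, uniformizer $\varpi$, $\mathfrak{p}=\varpi\mathfrak{o}$. $G=\mathrm{GSp}_4(F)=\{g:{}^tgJg=\mu(g)J\}$, $J$ with $J_{14}=J_{23}=-1$, $J_{32}=J_{41}=1$, zeros elsewhere. Fix a nonsquare $e\in\mathfrak{o}$, $\sigma=\begin{bmatrix}&e\\1&\end{bmatrix}$, $\iota=\mathrm{diag}(1,-1)$; $E=F+F\sigma\subset M_2(F)$ (a quadratic field), $\mathfrak{O}$ its ring of integers, $\varrho$ a generator of its maximal ideal. $\delta=2$ if $E/F$ is unramified and $F$ has residue characteristic 2, $\delta=1$ otherwise. $R=\mathfrak{O}+\mathfrak{O}\iota$, $R_m=\mathfrak{O}+\varrho^mR$. $K_{2m}$ ($m\ge0$) is the set of $g\in G$ with $\mu(g)\in\mathfrak{o}^\times$ whose $2\times2$ blocks satisfy $g_{11},g_{22}\in R_m$, $g_{12}\in\delta^{-1}\varrho^{-m}R_m$, $g_{21}\in\delta\varrho^mR_m$ (complete nonsplit paramodular group of level $m$ over the fixed field $E$). *)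

theory Defs
  imports "HOL-Analysis.Analysis" "HOL-Algebra.Ideal"
begin

section \<open>Nonarchimedean local fields of characteristic zero\<close>

text \<open>
  A field of characteristic zero, complete with respect to a nontrivial discrete
  nonarchimedean absolute value \<open>vabs\<close> with finite residue field. The absolute value induces
  the metric, so that \<open>'a^4^4\<close> carries the usual topology of \<open>M\<^sub>4(F)\<close> through the library
  instances for vectors. The normalization of \<open>vabs\<close> is left open.
\<close>

class nonarch_local_field = field_char_0 + complete_space +
  fixes vabs :: "'a \<Rightarrow> real"
  assumes dist_vabs: "dist x y = vabs (x - y)"
    and vabs_mult: "vabs (x * y) = vabs x * vabs y"
    and vabs_ultrametric: "vabs (x + y) \<le> max (vabs x) (vabs y)"
    and vabs_discrete: "\<exists>w. 0 < vabs w \<and> vabs w < 1 \<and> (\<forall>x. x \<noteq> 0 \<longrightarrow> (\<exists>n::int. vabs x = vabs w powi n))"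
    and finite_residue_field: "finite {{y. vabs (x - y) < 1} | x. vabs x \<le> 1}"

definition int_ring :: "'a::nonarch_local_field set" where
  "int_ring = {x. vabs x \<le> 1}"

definition int_units :: "'a::nonarch_local_field set" where
  "int_units = {x. vabs x = 1}"

definition max_ideal :: "'a::nonarch_local_field set" where
  "max_ideal = {x. vabs x < 1}"


section \<open>The quadratic field inside \<open>M\<^sub>2(F)\<close>\<close>

text \<open>
  On \<open>'a^'n^'n\<close> the matrix product is \<open>**\<close> (the type class product is componentwise), and
  \<open>mat c\<close> is the scalar matrix, so \<open>mat c ** A\<close> is the scalar multiple \<open>c A\<close>.
\<close>

definition mat2 :: "'a::zero \<Rightarrow> 'a \<Rightarrow> 'a \<Rightarrow> 'a \<Rightarrow> 'a^2^2" where
  "mat2 a b c d = vector [vector [a, b], vector [c, d]]"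

definition sigma :: "'a::field \<Rightarrow> 'a^2^2" where
  "sigma e = mat2 0 e 1 0"

definition iota :: "'a::field^2^2" where
  "iota = mat2 1 0 0 (-1)"

definition quad_field :: "'a::field \<Rightarrow> ('a^2^2) ring" where
  "quad_field e = \<lparr>carrier = {mat a + mat b ** sigma e | a b. True},
     monoid.mult = (**), one = mat 1, zero = 0, add = (+)\<rparr>"

text \<open>The integral closure of \<^const>\<open>int_ring\<close> in the quadratic field: roots of monic polynomials
  \<open>X\<^sup>n + \<Sum>i<n. c\<^sub>i X\<^sup>i\<close>.\<close>

definition quad_int_ring :: "'a::nonarch_local_field \<Rightarrow> ('a^2^2) ring" where
  "quad_int_ring e = (quad_field e)\<lparr>carrier :=
     {x \<in> carrier (quad_field e). \<exists>n c. (\<forall>i<n. c i \<in> int_ring) \<and>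
        x [^]\<^bsub>quad_field e\<^esub> (n::nat) + (\<Sum>i<n. mat (c i) ** (x [^]\<^bsub>quad_field e\<^esub> i)) = 0}\<rparr>"

text \<open>Ramification index one, that is, \<open>\<pp>\<OO>\<close> is the maximal ideal of \<open>\<OO>\<close>. The residue field
  extension is separable since the residue fields are finite. The set below is an ideal, since
  \<open>\<pp>\<close> is principal.\<close>

definition unramified :: "'a::nonarch_local_field \<Rightarrow> bool" where
  "unramified e \<longleftrightarrow>
     maximalideal {mat x ** y | x y. x \<in> max_ideal \<and> y \<in> carrier (quad_int_ring e)} (quad_int_ring e)"

text \<open>The residue characteristic is 2 iff 2 vanishes in the residue field.\<close>

definition delta :: "'a::nonarch_local_field \<Rightarrow> 'a" where
  "delta e = (if unramified e \<and> 2 \<in> (max_ideal :: 'a set) then 2 else 1)"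

definition R_order :: "'a::nonarch_local_field \<Rightarrow> ('a^2^2) set" where
  "R_order e = {x + y ** iota | x y. x \<in> carrier (quad_int_ring e) \<and> y \<in> carrier (quad_int_ring e)}"

definition R_level :: "'a::nonarch_local_field \<Rightarrow> 'a^2^2 \<Rightarrow> nat \<Rightarrow> ('a^2^2) set" where
  "R_level e \<rho> m = {x + (\<rho> [^]\<^bsub>quad_field e\<^esub> m) ** y | x y. x \<in> carrier (quad_int_ring e) \<and> y \<in> R_order e}"


section \<open>\<open>GSp\<^sub>4\<close> and the complete nonsplit paramodular groups\<close>

definition J4 :: "'a::field^4^4" where
  "J4 = (\<chi> i j. if (i, j) \<in> {(1, 4), (2, 3)} then -1
               else if (i, j) \<in> {(3, 2), (4, 1)} then 1 else 0)"

definition GSp4 :: "('a::field^4^4) monoid" where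
  "GSp4 = \<lparr>carrier = {g. \<exists>\<mu>. \<mu> \<noteq> 0 \<and> transpose g ** J4 ** g = mat \<mu> ** J4},
     monoid.mult = (**), one = mat 1\<rparr>"

definition similitude :: "'a::field^4^4 \<Rightarrow> 'a" where
  "similitude g = (THE \<mu>. transpose g ** J4 ** g = mat \<mu> ** J4)"

text \<open>\<open>paramodular e \<rho> m\<close> is the group written \<open>K\<^bsub>2m\<^esub>\<close>, where \<open>\<rho>\<close> generates the maximal ideal of
  \<open>\<OO>\<close>. The order of the factors matters: the powers of \<open>\<rho>\<close> multiply from the left.\<close>

definition paramodular :: "'a::nonarch_local_field \<Rightarrow> 'a^2^2 \<Rightarrow> nat \<Rightarrow> ('a^4^4) set" where
  "paramodular e \<rho> m =
     {g \<in> carrier GSp4. similitude g \<in> int_units \<and>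
        mat2 (g$1$1) (g$1$2)
             (g$2$1) (g$2$2) \<in> R_level e \<rho> m \<and>
        mat2 (g$3$3) (g$3$4)
             (g$4$3) (g$4$4) \<in> R_level e \<rho> m \<and>
        mat2 (g$1$3) (g$1$4)
             (g$2$3) (g$2$4) \<in> {mat (inverse (delta e)) ** (inv\<^bsub>quad_field e\<^esub> (\<rho> [^]\<^bsub>quad_field e\<^esub> m)) ** r | r.
                                  r \<in> R_level e \<rho> m} \<and>
        mat2 (g$3$1) (g$3$2)
             (g$4$1) (g$4$2) \<in> {mat (delta e) ** (\<rho> [^]\<^bsub>quad_field e\<^esub> m) ** r | r.
                                  r \<in> R_level e \<rho> m}}"


section \<open>Representations of \<open>PGSp\<^sub>4(F)\<close>\<close>

definition GL_on :: "(complex \<Rightarrow> 'v \<Rightarrow> 'v) \<Rightarrow> ('v::ab_group_add \<Rightarrow> 'v) monoid" where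
  "GL_on scl = \<lparr>carrier = {f. Vector_Spaces.linear scl scl f \<and> bij f},
     monoid.mult = (\<circ>), one = id\<rparr>"

text \<open>
  A representation of \<open>PGSp\<^sub>4(F)\<close> on the complex vector space \<open>'v\<close> is a representation of
  \<open>GSp\<^sub>4(F)\<close> on which the centre, the group of nonzero scalar matrices, acts trivially.
  The values of \<open>\<pi>\<close> outside \<open>GSp\<^sub>4(F)\<close> are irrelevant.
\<close>

locale PGSp4_rep = vector_space scl
  for scl :: "complex \<Rightarrow> 'v::ab_group_add \<Rightarrow> 'v" +
  fixes \<pi> :: "'a::nonarch_local_field^4^4 \<Rightarrow> 'v \<Rightarrow> 'v"
  assumes hom_GL: "\<pi> \<in> hom GSp4 (GL_on scl)"
    and centre_trivial: "z \<noteq> 0 \<Longrightarrow> \<pi> (mat z) = id"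
begin

definition fixed_space :: "('a^4^4) set \<Rightarrow> 'v set" where
  "fixed_space H = {v. \<forall>h\<in>H. \<pi> h v = v}"

definition fin_dim :: "'v set \<Rightarrow> bool" where
  "fin_dim W \<longleftrightarrow> (\<exists>B. finite B \<and> span B = W)"

definition smooth :: bool where
  "smooth \<longleftrightarrow> (\<forall>v. openin (top_of_set (carrier GSp4)) {g \<in> carrier GSp4. \<pi> g v = v})"

definition admissible :: bool where
  "admissible \<longleftrightarrow> smooth \<and>
     (\<forall>H. subgroup H GSp4 \<and> openin (top_of_set (carrier GSp4)) H \<and> compact H \<longrightarrow> fin_dim (fixed_space H))"

definition irreducible_rep :: bool where
  "irreducible_rep \<longleftrightarrow> (UNIV :: 'v set) \<noteq> {0} \<and>
     (\<forall>W. subspace W \<and> (\<forall>g\<in>carrier GSp4. \<pi> g ` W \<subseteq> W) \<longrightarrow> W = {0} \<or> W = UNIV)"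

end

end

theory Submission
  imports Defs
begin

text \<open>
  In a nontrivial relation let \<open>v\<close> be the vector of highest level \<open>m\<close> among those with nonzero
  coefficient. It is fixed by \<open>K\<^sub>2\<^sub>m\<close> and, being a combination of the others, by the lower
  unipotents with entry in \<open>\<delta> \<rho>\<^sup>m\<^sup>-\<^sup>1 \<OO>\<close>. Inside \<open>SL\<^sub>2(E) \<subseteq> Sp\<^sub>4(F)\<close> these generate the torus element
  \<open>diag(\<rho>\<^sup>-\<^sup>1, \<rho>)\<close>, whose conjugation action blows up the Siegel unipotents in \<open>K\<^sub>2\<^sub>m\<close> to the whole
  Siegel unipotent radical; with a Weyl element one gets all of \<open>Sp\<^sub>4(F)\<close>. Since \<open>v\<close> is also fixed by
  elements of every unit similitude, its orbit modulo the centre has at most two elements, so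
  irreducibility makes \<open>V\<close> finite-dimensional. The only arithmetic input is that the norm
  of \<open>E\<close> induces a valuation with valuation ring \<open>\<OO>\<close>.
\<close>

section \<open>The absolute value\<close>

lemma vabs_eq_dist: "vabs (x :: 'a::nonarch_local_field) = dist x 0"
  by (simp add: dist_vabs)

lemma vabs_nonneg [simp]: "0 \<le> vabs (x :: 'a::nonarch_local_field)"
  by (simp add: vabs_eq_dist)

lemma vabs_eq_0_iff [simp]: "vabs (x :: 'a::nonarch_local_field) = 0 \<longleftrightarrow> x = 0"
  by (simp add: vabs_eq_dist)

lemma vabs_0 [simp]: "vabs (0 :: 'a::nonarch_local_field) = 0"
  by simp

lemma vabs_pos_iff [simp]: "0 < vabs (x :: 'a::nonarch_local_field) \<longleftrightarrow> x \<noteq> 0"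
  by (metis less_le vabs_eq_0_iff vabs_nonneg)

lemma vabs_1 [simp]: "vabs (1 :: 'a::nonarch_local_field) = 1"
  using vabs_mult[of 1 "1 :: 'a"] by simp

lemma vabs_minus [simp]: "vabs (- x :: 'a::nonarch_local_field) = vabs x"
  by (metis dist_commute dist_vabs diff_0 vabs_eq_dist)

lemma vabs_power: "vabs (x ^ n :: 'a::nonarch_local_field) = vabs x ^ n"
  by (induction n) (simp_all add: vabs_mult)

lemma vabs_inverse: "vabs (inverse x :: 'a::nonarch_local_field) = inverse (vabs x)"
proof (cases "x = 0")
  case False
  then have "vabs x * vabs (inverse x) = 1"
    by (simp flip: vabs_mult)
  then show ?thesis
    by (simp add: inverse_unique)
qed simp

lemma vabs_divide: "vabs (x / y :: 'a::nonarch_local_field) = vabs x / vabs y"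
  by (simp add: divide_inverse vabs_mult vabs_inverse)

lemma vabs_add_le: "vabs (x :: 'a::nonarch_local_field) \<le> c \<Longrightarrow> vabs y \<le> c \<Longrightarrow> vabs (x + y) \<le> c"
  using vabs_ultrametric[of x y] by linarith

lemma vabs_add_eq:
  fixes x y :: "'a::nonarch_local_field"
  assumes "vabs y < vabs x"
  shows "vabs (x + y) = vabs x"
proof (rule antisym)
  show "vabs (x + y) \<le> vabs x"
    using assms by (intro vabs_add_le) auto
  show "vabs x \<le> vabs (x + y)"
    using vabs_ultrametric[of "x + y" "- y"] assms by simp
qed

lemma vabs_mult_le_1: "vabs (x :: 'a::nonarch_local_field) \<le> 1 \<Longrightarrow> vabs y \<le> 1 \<Longrightarrow> vabs (x * y) \<le> 1"
  by (simp add: vabs_mult mult_le_one)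

lemma vabs_2_le_1: "vabs (2 :: 'a::nonarch_local_field) \<le> 1"
  using vabs_add_le[of "1 :: 'a" 1 1] by simp

lemma closed_vabs_eq: "closed {x :: 'a::nonarch_local_field. vabs x = c}"
proof -
  have "{x :: 'a. vabs x = c} = cball 0 c - ball 0 c"
    by (auto simp: vabs_eq_dist dist_commute)
  then show ?thesis
    by (simp add: closed_Diff)
qed

text \<open>Hensel's lemma for \<open>X\<^sup>2 - X + c\<close>: the map \<open>y \<mapsto> 1 - c / y\<close> contracts the unit circle.\<close>

lemma quadratic_root:
  fixes c :: "'a::nonarch_local_field"
  assumes "vabs c < 1"
  obtains y where "y * y - y + c = 0"
proof -
  define S where "S = {x :: 'a. vabs x = 1}"
  define f where "f y = 1 - c / y" for y
  have "complete S"
    unfolding S_def complete_eq_closed by (rule closed_vabs_eq)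
  moreover have "S \<noteq> {}"
    unfolding S_def using vabs_1 by blast
  moreover have "f ` S \<subseteq> S"
  proof
    fix z assume "z \<in> f ` S"
    then obtain y where "vabs y = 1" and z: "z = 1 - c / y"
      by (auto simp: S_def f_def)
    then have "vabs (- (c / y)) < vabs (1 :: 'a)"
      using assms by (simp add: vabs_divide)
    from vabs_add_eq[OF this] show "z \<in> S"
      by (simp add: S_def z)
  qed
  moreover have "dist (f x) (f y) \<le> vabs c * dist x y" if "x \<in> S" "y \<in> S" for x y
  proof -
    have nz: "x \<noteq> 0" "y \<noteq> 0"
      using that by (auto simp: S_def)
    have "f x - f y = c * (x - y) / (x * y)"
      using nz by (simp add: f_def field_simps)
    then show ?thesis
      using that by (simp add: dist_vabs vabs_mult vabs_divide S_def)
  qed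
  ultimately obtain y where "y \<in> S" "f y = y"
    using Banach_fix[of S "vabs c" f] assms by auto
  then have "y \<noteq> 0" "1 - c / y = y"
    by (auto simp: S_def f_def)
  then have "y * y - y + c = 0"
    by (simp add: field_simps)
  then show thesis
    by (rule that)
qed

text \<open>If the trace t were not integral, rescaling X^2 - t X + n by t would give X^2 - X + n /
  t^2 with constant term in the maximal ideal. By \<open>quadratic_root\<close> the characteristic
  polynomial of a + b \<sigma> would then have a root in F, and completing the square would make e a
  square.\<close>

lemma trace_le_1_if_norm_le_1:
  fixes e :: "'a::nonarch_local_field"
  assumes nsq: "\<nexists>x. e = x\<^sup>2" and N: "vabs (a * a - e * b * b) \<le> 1"
  shows "vabs (2 * a) \<le> 1"
proof (rule ccontr)
  assume big: "\<not> vabs (2 * a) \<le> 1"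
  define t n c where "t = 2 * a" and "n = a * a - e * b * b" and "c = n / (t * t)"
  have t: "1 < vabs t" "t \<noteq> 0"
    using big by (auto simp: t_def)
  have "vabs n < vabs t * vabs t"
    using t(1) N unfolding n_def[symmetric] by (smt (verit) mult_less_cancel_left1)
  then have "vabs c < 1"
    using t by (simp add: c_def vabs_divide vabs_mult)
  then obtain y where "y * y - y + c = 0"
    by (rule quadratic_root)
  then have "(y * y - y + c) * (t * t) = 0"
    by simp
  then have "(t * y) * (t * y) - t * (t * y) + n = 0"
    using t(2) by (simp add: c_def algebra_simps)
  then have sq: "(t * y - a)\<^sup>2 = e * b\<^sup>2"
    by (simp add: t_def n_def power2_eq_square algebra_simps)
  show False
  \<comment> \<open>For b = 0 the equation says nothing about e; here the norm is a^2, which already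
    bounds a and hence 2 a.\<close>
  proof (cases "b = 0")
    case True
    then have "vabs a * vabs a \<le> 1"
      using N by (simp add: vabs_mult)
    then have "vabs a \<le> 1"
      by (smt (verit) mult_less_cancel_left1)
    then show False
      using big vabs_mult_le_1[OF vabs_2_le_1] by blast
  next
    case False
    then have "e = ((t * y - a) / b)\<^sup>2"
      using sq by (simp add: power_divide)
    then show False
      using nsq by blast
  qed
qed

section \<open>The quadratic field\<close>

lemma matrix_mul_add_left: "(A + B) ** C = A ** C + B ** (C :: 'a::semiring_1^'n^'m)"
  by (simp add: vec_eq_iff matrix_matrix_mult_def distrib_right sum.distrib)

lemma mat2_nth [simp]:
  "mat2 a b c d $ 1 $ 1 = a" "mat2 a b c d $ 1 $ 2 = b"
  "mat2 a b c d $ 2 $ 1 = c" "mat2 a b c d $ 2 $ 2 = d"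
  by (simp_all add: mat2_def)

lemma mat2_eq_iff: "(A :: 'a::zero^2^2) = B \<longleftrightarrow>
    A $ 1 $ 1 = B $ 1 $ 1 \<and> A $ 1 $ 2 = B $ 1 $ 2 \<and> A $ 2 $ 1 = B $ 2 $ 1 \<and> A $ 2 $ 2 = B $ 2 $ 2"
  by (auto simp: vec_eq_iff forall_2)

lemma mat2_collapse: "mat2 (A $ 1 $ 1) (A $ 1 $ 2) (A $ 2 $ 1) (A $ 2 $ 2) = A"
  by (simp add: mat2_eq_iff)

lemma mat2_mult: "mat2 a b c d ** mat2 a' b' c' d' =
    mat2 (a * a' + b * c') (a * b' + b * d') (c * a' + d * c') (c * b' + d * d' :: 'a::semiring_1)"
  by (simp add: mat2_eq_iff matrix_matrix_mult_def sum_2)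

lemma mat2_add: "mat2 a b c d + mat2 a' b' c' d' =
    mat2 (a + a') (b + b') (c + c') (d + d' :: 'a::monoid_add)"
  by (simp add: mat2_eq_iff)

lemma mat2_minus: "- mat2 a b c d = mat2 (- a) (- b) (- c) (- d :: 'a::group_add)"
  by (simp add: mat2_eq_iff)

lemma mat_eq_mat2: "mat a = mat2 a 0 0 (a :: 'a::zero)"
  by (simp add: mat2_eq_iff mat_def)

lemma zero_eq_mat2: "0 = mat2 0 0 0 (0 :: 'a::zero)"
  by (simp add: mat2_eq_iff)

lemma det_mat2: "det (mat2 a b c d) = a * d - b * (c :: 'a::comm_ring_1)"
  by (simp add: det_2)

lemmas mat2_simps = mat2_mult mat2_add mat2_minus mat_eq_mat2 zero_eq_mat2 det_mat2

text \<open>The element a + b \<sigma> written out as a matrix, so that \<open>det\<close>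
  restricted to E is the norm to F. The norm appears only as \<open>det\<close> below.\<close>

definition quad_elt :: "'a::field \<Rightarrow> 'a \<Rightarrow> 'a \<Rightarrow> 'a^2^2" where
  "quad_elt e a b = mat2 a (e * b) b a"

lemma carrier_quad_field: "carrier (quad_field e) = {quad_elt e a b | a b. True}"
  by (simp add: quad_field_def quad_elt_def sigma_def mat2_simps mult.commute)

lemma quad_field_simps [simp]:
  "x \<otimes>\<^bsub>quad_field e\<^esub> y = x ** y" "\<one>\<^bsub>quad_field e\<^esub> = mat 1" 
  by (simp_all add: quad_field_def)

lemma quad_elt_in [simp]: "quad_elt e a b \<in> carrier (quad_field e)"
  by (auto simp: carrier_quad_field)

lemma quad_elt_mult: "quad_elt e a b ** quad_elt e c d = quad_elt e (a * c + e * b * d) (a * d + b * c)"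
  by (simp add: quad_elt_def mat2_simps mat2_eq_iff algebra_simps)

lemma quad_elt_add: "quad_elt e a b + quad_elt e c d = quad_elt e (a + c) (b + d)"
  by (simp add: quad_elt_def mat2_simps mat2_eq_iff algebra_simps)

lemma quad_elt_minus: "- quad_elt e a b = quad_elt e (- a) (- b)"
  by (simp add: quad_elt_def mat2_simps)

lemma mat_eq_quad_elt: "mat a = quad_elt e a 0"
  by (simp add: quad_elt_def mat2_simps)

lemma det_quad_elt: "det (quad_elt e a b) = a * a - e * b * b"
  by (simp add: quad_elt_def det_mat2)

lemma det_mat2x2: "det (mat a :: 'a::comm_ring_1^2^2) = a * a"
  by (simp add: mat2_simps)

lemma det_uminus_2: "det (- A) = det (A :: 'a::comm_ring_1^2^2)"
  by (simp add: det_2)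

lemma mat_in_quad_field [simp]: "mat a \<in> carrier (quad_field e)"
  by (simp add: mat_eq_quad_elt[of _ e])

lemma zero_in_quad_field [simp]: "0 \<in> carrier (quad_field e)"
  using mat_in_quad_field[of 0 e] by (simp add: mat_eq_mat2 zero_eq_mat2)

lemma quad_field_closed [intro]:
  assumes "x \<in> carrier (quad_field e)" "y \<in> carrier (quad_field e)"
  shows "x ** y \<in> carrier (quad_field e)" "x + y \<in> carrier (quad_field e)" "- x \<in> carrier (quad_field e)"
proof -
  obtain a b c d where "x = quad_elt e a b" "y = quad_elt e c d"
    using assms by (auto simp: carrier_quad_field)
  then show "x ** y \<in> carrier (quad_field e)" "x + y \<in> carrier (quad_field e)" "- x \<in> carrier (quad_field e)"
    by (simp_all add: quad_elt_mult quad_elt_add quad_elt_minus)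
qed

lemma quad_field_commute:
  assumes "x \<in> carrier (quad_field e)" "y \<in> carrier (quad_field e)"
  shows "x ** y = y ** x"
proof -
  obtain a b c d where "x = quad_elt e a b" "y = quad_elt e c d"
    using assms by (auto simp: carrier_quad_field)
  then show ?thesis
    by (simp add: quad_elt_mult algebra_simps)
qed

lemma monoid_quad_field: "monoid (quad_field e)"
  by (rule monoidI) (auto simp: matrix_mul_assoc)

lemma quad_pow_closed [intro]:
  "x \<in> carrier (quad_field e) \<Longrightarrow> x [^]\<^bsub>quad_field e\<^esub> (n::nat) \<in> carrier (quad_field e)"
  by (rule monoid.nat_pow_closed[OF monoid_quad_field])

lemma quad_pow_simps [simp]:
  "x [^]\<^bsub>quad_field e\<^esub> (0::nat) = mat 1"
  "x [^]\<^bsub>quad_field e\<^esub> Suc n = (x [^]\<^bsub>quad_field e\<^esub> n) ** x"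
  by (simp_all add: monoid.nat_pow_0[OF monoid_quad_field] monoid.nat_pow_Suc[OF monoid_quad_field])

lemma det_quad_pow: "det (x [^]\<^bsub>quad_field e\<^esub> n) = det x ^ (n::nat)"
  by (induction n) (simp_all add: det_mul det_mat2x2 mult.commute)

lemma det_quad_field_nonzero:
  assumes "\<nexists>x. e = x\<^sup>2" "x \<in> carrier (quad_field e)" "x \<noteq> 0"
  shows "det x \<noteq> 0"
proof
  obtain a b where x: "x = quad_elt e a b"
    using assms(2) by (auto simp: carrier_quad_field)
  assume "det x = 0"
  then have *: "a * a = e * b * b"
    by (simp add: x det_quad_elt)
  show False
  proof (cases "b = 0")
    case True
    then show False
      using * assms(3) by (simp add: x quad_elt_def zero_eq_mat2)
  next
    case False
    then have "e = (a / b)\<^sup>2"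
      using * by (simp add: power2_eq_square)
    then show False
      using assms(1) by blast
  qed
qed

lemma quad_field_inverse:
  assumes "x \<in> carrier (quad_field e)" "det x \<noteq> 0"
  obtains y where "y \<in> carrier (quad_field e)" "x ** y = mat 1" "y ** x = mat 1"
    "inv\<^bsub>quad_field e\<^esub> x = y" "det y = inverse (det x)"
proof -
  obtain a b where x: "x = quad_elt e a b"
    using assms(1) by (auto simp: carrier_quad_field)
  define y where "y = quad_elt e (a / det x) (- b / det x)"
  have "(a * a - e * b * b) / det x = 1"
    using assms(2) by (simp add: x det_quad_elt)
  then have xy: "x ** y = mat 1"
    by (simp add: x y_def quad_elt_mult mat_eq_quad_elt[of _ e] diff_divide_distrib mult.commute)
  have y: "y \<in> carrier (quad_field e)"
    by (simp add: y_def)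
  have yx: "y ** x = mat 1"
    using xy quad_field_commute[OF assms(1) y] by simp
  have inv: "inv\<^bsub>quad_field e\<^esub> x = y"
    using monoid.inv_unique'[OF monoid_quad_field assms(1) y] xy yx by simp
  have "det x * det y = 1"
    using xy by (metis det_mul det_I)
  then have "det y = inverse (det x)"
    by (simp add: inverse_unique)
  then show thesis
    using that y xy yx inv by blast
qed

section \<open>The valuation of E given by the norm, and its valuation ring\<close>

lemma vabs_det_add_one_le:
  fixes e :: "'a::nonarch_local_field"
  assumes "\<nexists>x. e = x\<^sup>2" "x \<in> carrier (quad_field e)" "vabs (det x) \<le> 1"
  shows "vabs (det (x + mat 1)) \<le> 1"
proof -
  obtain a b where x: "x = quad_elt e a b"
    using assms(2) by (auto simp: carrier_quad_field)
  have "vabs (2 * a) \<le> 1"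
    using trace_le_1_if_norm_le_1[OF assms(1), of a b] assms(3) by (simp add: x det_quad_elt)
  moreover have "det (x + mat 1) = 2 * a + 1 + det x"
    by (simp add: x mat_eq_quad_elt[of _ e] quad_elt_add det_quad_elt algebra_simps)
  ultimately show ?thesis
    using assms(3) by (simp add: vabs_add_le)
qed

text \<open>Division by the summand of larger norm reduces the ultrametric inequality to N(z + 1) =
  N(z) + tr(z) + 1 with N(z) integral, where tr(z) is integral by
  \<open>trace_le_1_if_norm_le_1\<close>.\<close>

lemma vabs_det_add_le:
  fixes e :: "'a::nonarch_local_field"
  assumes nsq: "\<nexists>x. e = x\<^sup>2"
    and x: "x \<in> carrier (quad_field e)" "vabs (det x) \<le> c"
    and y: "y \<in> carrier (quad_field e)" "vabs (det y) \<le> c"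
  shows "vabs (det (x + y)) \<le> c"
proof -
  have *: "vabs (det (x + y)) \<le> vabs (det y)"
    if xy: "x \<in> carrier (quad_field e)" "y \<in> carrier (quad_field e)" "vabs (det x) \<le> vabs (det y)" "det y \<noteq> 0"
    for x y
  proof -
    obtain z where z: "z \<in> carrier (quad_field e)" "z ** y = mat 1" "det z = inverse (det y)"
      using quad_field_inverse[OF xy(2,4)] by metis
    have "vabs (det (x ** z)) = vabs (det x) / vabs (det y)"
      by (simp add: det_mul z vabs_mult vabs_inverse divide_inverse)
    then have "vabs (det (x ** z)) \<le> 1"
      using that by (simp add: divide_le_eq_1)
    then have "vabs (det (x ** z + mat 1)) \<le> 1"
      using that z by (intro vabs_det_add_one_le[OF nsq]) auto
    moreover have "x + y = (x ** z + mat 1) ** y"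
      by (simp add: matrix_mul_add_left z flip: matrix_mul_assoc)
    ultimately show ?thesis
      by (simp add: det_mul vabs_mult mult_left_le_one_le)
  qed
  show ?thesis
  proof (cases "x = 0 \<or> y = 0")
    case False
    then have "det x \<noteq> 0" "det y \<noteq> 0"
      using det_quad_field_nonzero[OF nsq] x y by auto
    then show ?thesis
      using *[of x y] *[of y x] x y by (cases "vabs (det x) \<le> vabs (det y)") (auto simp: add.commute)
  qed (use x y in auto)
qed

lemma vabs_det_sum_le:
  fixes e :: "'a::nonarch_local_field"
  assumes nsq: "\<nexists>x. e = x\<^sup>2" and "0 \<le> c"
    and "\<And>i. i \<in> I \<Longrightarrow> f i \<in> carrier (quad_field e) \<and> vabs (det (f i)) \<le> c"
  shows "(\<Sum>i\<in>I. f i) \<in> carrier (quad_field e) \<and> vabs (det (\<Sum>i\<in>I. f i)) \<le> c"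
  using assms(3)
proof (induction I rule: infinite_finite_induct)
  case (insert i I)
  then show ?case
    using vabs_det_add_le[OF nsq] by auto
qed (use \<open>0 \<le> c\<close> in \<open>simp_all add: det_2\<close>)

text \<open>An element of integral norm is a root of its characteristic polynomial, whose trace
  coefficient is integral as well. Conversely, if the norm of x exceeds 1, then the leading term of
  a monic integral equation strictly dominates all lower powers. All later integrality checks become
  norm estimates through this description.\<close>

lemma carrier_quad_int_ring:
  fixes e :: "'a::nonarch_local_field"
  assumes nsq: "\<nexists>x. e = x\<^sup>2"
  shows "carrier (quad_int_ring e) = {x \<in> carrier (quad_field e). vabs (det x) \<le> 1}"
proof (intro equalityI subsetI)
  fix x assume "x \<in> {x \<in> carrier (quad_field e). vabs (det x) \<le> 1}"
  then have x: "x \<in> carrier (quad_field e)" "vabs (det x) \<le> 1"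
    by auto
  obtain a b where xab: "x = quad_elt e a b"
    using x(1) by (auto simp: carrier_quad_field)
  define c where "c i = (if i = 0 then det x else - (2 * a))" for i :: nat
  have "\<forall>i<2. c i \<in> int_ring"
    using x trace_le_1_if_norm_le_1[OF nsq, of a b]
    by (simp add: xab c_def int_ring_def det_quad_elt)
  moreover have "x [^]\<^bsub>quad_field e\<^esub> (2::nat) + (\<Sum>i<2. mat (c i) ** (x [^]\<^bsub>quad_field e\<^esub> i)) = 0"
    by (simp add: xab c_def numeral_2_eq_2 det_quad_elt)
      (simp add: quad_elt_def mat2_simps algebra_simps)
  ultimately show "x \<in> carrier (quad_int_ring e)"
    using x(1) unfolding quad_int_ring_def by auto
next
  fix x assume "x \<in> carrier (quad_int_ring e)"
  then obtain n c where x: "x \<in> carrier (quad_field e)" and c: "\<And>i. i < n \<Longrightarrow> vabs (c i) \<le> 1"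
    and eq: "x [^]\<^bsub>quad_field e\<^esub> (n::nat) + (\<Sum>i<n. mat (c i) ** (x [^]\<^bsub>quad_field e\<^esub> i)) = 0"
    unfolding quad_int_ring_def int_ring_def by auto
  have "vabs (det x) \<le> 1"
  proof (rule ccontr)
    assume big: "\<not> ?thesis"
    define s where "s = (\<Sum>i<n. mat (c i) ** (x [^]\<^bsub>quad_field e\<^esub> i))"
    \<comment> \<open>In degree 0 the equation would read 1 = 0. Positivity of n makes the exponent
      n - 1 of the bound strictly smaller than n.\<close>
    have "n \<noteq> 0"
      using eq by (intro notI) (simp add: mat2_simps mat2_eq_iff)
    have "vabs (det s) \<le> vabs (det x) ^ (n - 1)"
    proof -
      have "vabs (det (mat (c i) ** (x [^]\<^bsub>quad_field e\<^esub> i))) \<le> vabs (det x) ^ (n - 1)" if "i < n" for i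
      proof -
        have "vabs (det x) ^ i \<le> vabs (det x) ^ (n - 1)"
          using big that by (intro power_increasing) auto
        moreover have "vabs (c i * c i) \<le> 1"
          using c[OF that] by (intro vabs_mult_le_1)
        ultimately have "vabs (c i * c i) * vabs (det x) ^ i \<le> 1 * vabs (det x) ^ (n - 1)"
          by (intro mult_mono) auto
        then show ?thesis
          by (simp add: det_mul det_mat2x2 det_quad_pow vabs_mult vabs_power)
      qed
      then show ?thesis
        unfolding s_def using x
        by (intro vabs_det_sum_le[OF nsq, THEN conjunct2]) auto
    qed
    also have "\<dots> < vabs (det x) ^ n"
      using big \<open>n \<noteq> 0\<close> by (intro power_strict_increasing) auto
    also have "\<dots> = vabs (det s)"
    proof -
      have "s = - (x [^]\<^bsub>quad_field e\<^esub> n)"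
        using eq by (simp add: s_def eq_neg_iff_add_eq_0 add.commute)
      then have "det s = det (x [^]\<^bsub>quad_field e\<^esub> n)"
        by (simp add: det_2)
      then show ?thesis
        by (simp add: det_quad_pow vabs_power)
    qed
    finally show False
      by simp
  qed
  then show "x \<in> {x \<in> carrier (quad_field e). vabs (det x) \<le> 1}"
    using x by simp
qed

lemma quad_int_ring_simps [simp]:
  "x \<otimes>\<^bsub>quad_int_ring e\<^esub> y = x ** y" "\<one>\<^bsub>quad_int_ring e\<^esub> = mat 1"
  "x \<oplus>\<^bsub>quad_int_ring e\<^esub> y = x + y" "\<zero>\<^bsub>quad_int_ring e\<^esub> = 0"
  by (simp_all add: quad_int_ring_def quad_field_def)

text \<open>The elements of norm less than 1 form a proper ideal, so they are the only maximal ideal.\<close>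

lemma uniformizer_norm:
  fixes e :: "'a::nonarch_local_field"
  assumes nsq: "\<nexists>x. e = x\<^sup>2" and \<rho>: "\<rho> \<in> carrier (quad_int_ring e)"
    and max: "maximalideal (PIdl\<^bsub>quad_int_ring e\<^esub> \<rho>) (quad_int_ring e)"
  shows "vabs (det \<rho>) < 1" "det \<rho> \<noteq> 0"
proof -
  let ?O = "quad_int_ring e"
  define M where "M = {x \<in> carrier (quad_field e). vabs (det x) < 1}"
  have idl: "ideal (PIdl\<^bsub>?O\<^esub> \<rho>) ?O"
    using max by (rule maximalideal.axioms)
  then have ring: "ring ?O"
    by (rule ideal.axioms)
  note carr = carrier_quad_int_ring[OF nsq]
  have "mat 1 \<notin> PIdl\<^bsub>?O\<^esub> \<rho>"
    using maximalideal.I_notcarr[OF max] ideal.one_imp_carrier[OF idl] by auto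
  show lt: "vabs (det \<rho>) < 1"
  proof (rule ccontr)
    assume "\<not> ?thesis"
    with \<rho> have 1: "vabs (det \<rho>) = 1" "\<rho> \<in> carrier (quad_field e)"
      by (auto simp: carr)
    then have "det \<rho> \<noteq> 0"
      by auto
    then obtain y where "y \<in> carrier (quad_field e)" "y ** \<rho> = mat 1" "det y = inverse (det \<rho>)"
      using quad_field_inverse 1 by metis
    then have "y \<in> carrier ?O" "mat 1 = y ** \<rho>"
      using 1 by (simp_all add: carr vabs_inverse)
    then have "mat 1 \<in> PIdl\<^bsub>?O\<^esub> \<rho>"
      by (auto simp: cgenideal_def)
    with \<open>mat 1 \<notin> _\<close> show False
      by simp
  qed
  have "ideal M ?O"
  proof (rule idealI)
    show "ring ?O"
      by (rule ring)
    \<comment> \<open>The additive inverse of the ring record is given only abstractly; uniqueness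
      identifies it with matrix negation.\<close>
    have neg: "\<ominus>\<^bsub>?O\<^esub> x = - x" if "x \<in> carrier ?O" for x
    proof -
      have "x + \<ominus>\<^bsub>?O\<^esub> x = 0"
        using abelian_group.r_neg[OF ring.is_abelian_group[OF ring] that] by simp
      then show ?thesis
        by (rule minus_unique[symmetric])
    qed
    have "M \<subseteq> carrier ?O"
      by (auto simp: M_def carr)
    then show "subgroup M (add_monoid ?O)"
    proof (intro subgroup.intro)
      fix x y assume "x \<in> M" "y \<in> M"
      then have "vabs (det (x + y)) \<le> max (vabs (det x)) (vabs (det y))"
        by (intro vabs_det_add_le[OF nsq]) (auto simp: M_def)
      then show "x \<otimes>\<^bsub>add_monoid ?O\<^esub> y \<in> M"
        using \<open>x \<in> M\<close> \<open>y \<in> M\<close> by (auto simp: M_def)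
    next
      fix x assume "x \<in> M"
      then have "- x \<in> M"
        by (auto simp: M_def det_2)
      then show "inv\<^bsub>add_monoid ?O\<^esub> x \<in> M"
        using neg \<open>x \<in> M\<close> \<open>M \<subseteq> _\<close> by (auto simp: a_inv_def)
    qed (auto simp: M_def det_2)
  next
    fix a x assume "a \<in> M" "x \<in> carrier ?O"
    then have "vabs (det x) * vabs (det a) < 1"
      using mult_left_le_one_le[of "vabs (det a)" "vabs (det x)"] by (simp add: M_def carr)
    then show "x \<otimes>\<^bsub>?O\<^esub> a \<in> M" "a \<otimes>\<^bsub>?O\<^esub> x \<in> M"
      using \<open>a \<in> M\<close> \<open>x \<in> carrier ?O\<close>
      by (auto simp: M_def carr det_mul vabs_mult mult.commute)
  qed
  moreover have "PIdl\<^bsub>?O\<^esub> \<rho> \<subseteq> M"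
  proof
    fix z assume "z \<in> PIdl\<^bsub>?O\<^esub> \<rho>"
    then obtain x where x: "x \<in> carrier ?O" and z: "z = x ** \<rho>"
      by (auto simp: cgenideal_def)
    have "vabs (det x) * vabs (det \<rho>) < 1"
      using lt x mult_left_le_one_le[of "vabs (det \<rho>)" "vabs (det x)"] by (simp add: carr)
    then show "z \<in> M"
      using x \<rho> by (auto simp: z M_def carr det_mul vabs_mult)
  qed
  moreover have "M \<subseteq> carrier ?O" "mat 1 \<in> carrier ?O" "mat 1 \<notin> M"
    by (auto simp: M_def carr)
  ultimately have "M = PIdl\<^bsub>?O\<^esub> \<rho>"
    using maximalideal.I_maximal[OF max, of M] by blast
  moreover obtain w :: 'a where w: "0 < vabs w" "vabs w < 1"
    using vabs_discrete by blast
  \<comment> \<open>A nonzero scalar in M is a multiple of \<rho>, and taking norms excludes norm 0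
    for \<rho>.\<close>
  have "mat w \<in> M"
    using w mult_strict_mono[of "vabs w" 1 "vabs w" 1] by (simp add: M_def det_mat2x2 vabs_mult)
  ultimately obtain x where "mat w = x ** \<rho>"
    by (auto simp: cgenideal_def)
  then have "w * w = det x * det \<rho>"
    by (metis det_mat2x2 det_mul)
  then show "det \<rho> \<noteq> 0"
    using w by auto
qed

section \<open>Generators of the symplectic group\<close>

lemma vector_4 [simp]:
  "(vector [x, y, z, w] :: 'a::zero^4) $ 1 = x" "(vector [x, y, z, w] :: 'a::zero^4) $ 2 = y"
  "(vector [x, y, z, w] :: 'a::zero^4) $ 3 = z" "(vector [x, y, z, w] :: 'a::zero^4) $ 4 = w"
  unfolding vector_def by simp_all

section \<open>Block matrices\<close>

definition blk :: "'a::zero^2^2 \<Rightarrow> 'a^2^2 \<Rightarrow> 'a^2^2 \<Rightarrow> 'a^2^2 \<Rightarrow> 'a^4^4" where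
  "blk A B C D = vector
     [vector [A$1$1, A$1$2, B$1$1, B$1$2], vector [A$2$1, A$2$2, B$2$1, B$2$2],
      vector [C$1$1, C$1$2, D$1$1, D$1$2], vector [C$2$1, C$2$2, D$2$1, D$2$2]]"

lemma blk_nth [simp]:
  "blk A B C D $ 1 $ 1 = A $ 1 $ 1" "blk A B C D $ 1 $ 2 = A $ 1 $ 2"
  "blk A B C D $ 1 $ 3 = B $ 1 $ 1" "blk A B C D $ 1 $ 4 = B $ 1 $ 2"
  "blk A B C D $ 2 $ 1 = A $ 2 $ 1" "blk A B C D $ 2 $ 2 = A $ 2 $ 2"
  "blk A B C D $ 2 $ 3 = B $ 2 $ 1" "blk A B C D $ 2 $ 4 = B $ 2 $ 2"
  "blk A B C D $ 3 $ 1 = C $ 1 $ 1" "blk A B C D $ 3 $ 2 = C $ 1 $ 2"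
  "blk A B C D $ 3 $ 3 = D $ 1 $ 1" "blk A B C D $ 3 $ 4 = D $ 1 $ 2"
  "blk A B C D $ 4 $ 1 = C $ 2 $ 1" "blk A B C D $ 4 $ 2 = C $ 2 $ 2"
  "blk A B C D $ 4 $ 3 = D $ 2 $ 1" "blk A B C D $ 4 $ 4 = D $ 2 $ 2"
  by (simp_all add: blk_def)

lemma blk_eq_iff: "blk A B C D = blk A' B' C' D' \<longleftrightarrow> A = A' \<and> B = B' \<and> C = C' \<and> D = D'"
  by (auto simp: vec_eq_iff forall_4 forall_2)

lemma blk_cases: obtains A B C D where "g = blk A B C D"
proof
  show "g = blk (mat2 (g$1$1) (g$1$2) (g$2$1) (g$2$2)) (mat2 (g$1$3) (g$1$4) (g$2$3) (g$2$4))
     (mat2 (g$3$1) (g$3$2) (g$4$1) (g$4$2)) (mat2 (g$3$3) (g$3$4) (g$4$3) (g$4$4))"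
    by (simp add: vec_eq_iff forall_4)
qed

lemma blk_mult: "blk A B C D ** blk A' B' C' D' =
    blk (A ** A' + B ** C') (A ** B' + B ** D') (C ** A' + D ** C') (C ** B' + D ** D' :: 'a::semiring_1^2^2)"
  by (simp add: vec_eq_iff forall_4 matrix_matrix_mult_def sum_2 sum_4 add.assoc)

lemma blk_minus: "- blk A B C D = blk (- A) (- B) (- C) (- D :: 'a::ab_group_add^2^2)"
  by (simp add: vec_eq_iff forall_4)

lemma transpose_blk: "transpose (blk A B C D) = blk (transpose A) (transpose C) (transpose B) (transpose D)"
  by (simp add: vec_eq_iff forall_4 transpose_def)

lemma mat_eq_blk: "mat a = blk (mat a) 0 0 (mat a :: 'a::zero^2^2)"
  by (simp add: vec_eq_iff forall_4 mat_def)

lemma matrix_mul_zero [simp]: "(0 :: 'a::semiring_1^'n^'m) ** B = 0" "A ** (0 :: 'a^'k^'n) = 0"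
  by (simp_all add: vec_eq_iff matrix_matrix_mult_def)

lemma matrix_mul_minus [simp]:
  "(- A :: 'a::ring_1^'n^'m) ** B = - (A ** B)" "A ** (- B :: 'a^'k^'n) = - (A ** B)"
  by (simp_all add: vec_eq_iff matrix_matrix_mult_def sum_negf)

lemma J4_eq_blk: "J4 = blk 0 (mat2 0 (- 1) (- 1) 0) (mat2 0 1 1 0) (0 :: 'a::field^2^2)"
  by (simp add: vec_eq_iff forall_4 J4_def)

lemma J4_square: "J4 ** J4 = - (mat 1 :: 'a::field^4^4)"
  by (simp add: J4_eq_blk mat_eq_blk blk_mult blk_minus blk_eq_iff) (simp add: mat2_simps)

section \<open>The symplectic group and its Siegel unipotents\<close>

definition sp4 :: "('a::field^4^4) set" where
  "sp4 = {g. transpose g ** J4 ** g = J4}"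

definition upper :: "'a::zero_neq_one^2^2 \<Rightarrow> 'a^4^4" where
  "upper X = blk (mat 1) X 0 (mat 1)"

definition lower :: "'a::zero_neq_one^2^2 \<Rightarrow> 'a^4^4" where
  "lower X = blk (mat 1) 0 X (mat 1)"

text \<open>Symmetry about the antidiagonal, which for 2 x 2 matrices constrains only the diagonal.
  For this form J it is the condition that makes \<open>upper X\<close> and \<open>lower X\<close>
  symplectic.\<close>

definition persym :: "'a^2^2 \<Rightarrow> bool" where
  "persym X \<longleftrightarrow> X $ 1 $ 1 = X $ 2 $ 2"

text \<open>The matrix \<open>transpose g ** J4 ** g\<close> is alternating, so the six pairings of
  distinct columns of g determine it.\<close>

lemma blk_mem_sp4: "blk A B C D \<in> sp4 \<longleftrightarrow>
    A$1$1 * C$2$2 + A$2$1 * C$1$2 = A$1$2 * C$2$1 + A$2$2 * C$1$1 \<and>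
    B$1$1 * D$2$2 + B$2$1 * D$1$2 = B$1$2 * D$2$1 + B$2$2 * D$1$1 \<and>
    A$1$1 * D$2$1 + A$2$1 * D$1$1 = C$1$1 * B$2$1 + C$2$1 * B$1$1 \<and>
    A$1$2 * D$2$2 + A$2$2 * D$1$2 = C$1$2 * B$2$2 + C$2$2 * B$1$2 \<and>
    A$1$1 * D$2$2 + A$2$1 * D$1$2 = C$1$1 * B$2$2 + C$2$1 * B$1$2 + 1 \<and>
    A$1$2 * D$2$1 + A$2$2 * D$1$1 = C$1$2 * B$2$1 + C$2$2 * B$1$1 + (1 :: 'a::field)"
proof -
  have "blk A B C D \<in> sp4 \<longleftrightarrow>
     transpose A ** mat2 0 1 1 0 ** C = transpose C ** mat2 0 1 1 0 ** A \<and>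
     transpose A ** mat2 0 1 1 0 ** D = transpose C ** mat2 0 1 1 0 ** B + mat2 0 1 1 0 \<and>
     transpose D ** mat2 0 1 1 0 ** A = transpose B ** mat2 0 1 1 0 ** C + mat2 0 1 1 0 \<and>
     transpose B ** mat2 0 1 1 0 ** D = transpose D ** mat2 0 1 1 0 ** B"
  proof -
    have J: "J4 = blk 0 (- mat2 0 1 1 0) (mat2 0 1 1 0) (0 :: 'a^2^2)"
      by (simp add: J4_eq_blk mat2_minus)
    show ?thesis
      unfolding sp4_def mem_Collect_eq transpose_blk J blk_mult blk_eq_iff
      by (auto simp: algebra_simps eq_neg_iff_add_eq_0 matrix_mul_assoc)
  qed
  then show ?thesis
    by (auto simp: mat2_eq_iff matrix_matrix_mult_def sum_2 transpose_def algebra_simps)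
qed

lemma sp4_mult: "g \<in> sp4 \<Longrightarrow> h \<in> sp4 \<Longrightarrow> g ** h \<in> sp4"
  unfolding sp4_def by (simp add: matrix_transpose_mul) (metis matrix_mul_assoc)

lemma sp4_left_inverse:
  fixes g :: "'a::field^4^4"
  assumes "g \<in> sp4"
  obtains h where "h ** g = mat 1"
proof
  have "J4 ** (transpose g ** J4 ** g) = - mat 1"
    using assms by (simp add: sp4_def J4_square)
  then show "(- (J4 ** transpose g ** J4)) ** g = mat 1"
    by (simp add: matrix_mul_assoc)
qed

lemma upper_mult: "upper X ** upper Y = upper (X + Y :: 'a::field^2^2)"
  by (simp add: upper_def blk_mult blk_eq_iff add.commute)

text \<open>The SL_2 identity for a Weyl element, with 2 x 2 blocks as entries. A unipotent and an
  opposite unipotent with inverse entries suffice, which is how lattices of different levels come to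
  interact.\<close>

lemma weyl_element:
  fixes x y :: "'a::field^2^2"
  assumes "x ** y = mat 1" "y ** x = mat 1"
  shows "upper x ** lower (- y) ** upper x = blk 0 x (- y) 0"
  by (simp add: upper_def lower_def blk_mult blk_eq_iff assms matrix_add_ldistrib matrix_mul_add_left)

lemma upper_in_sp4: "persym X \<Longrightarrow> upper X \<in> (sp4 :: ('a::field^4^4) set)"
  and lower_in_sp4: "persym X \<Longrightarrow> lower X \<in> (sp4 :: ('a::field^4^4) set)"
  by (simp_all add: upper_def lower_def blk_mem_sp4 persym_def mat_def)

text \<open>The values of \<open>det (A + X C)\<close> at \<open>X = 0, \<plusminus>1, E\<^sub>1\<^sub>2, E\<^sub>2\<^sub>1\<close> and the symplectic relation determine
  the six \<open>2 \<times> 2\<close> minors of the first two columns, which cannot all vanish.\<close>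

lemma sp4_make_invertible:
  fixes A B C D :: "'a::field_char_0^2^2"
  assumes sp: "blk A B C D \<in> sp4"
  shows "\<exists>X. persym X \<and> det (A + X ** C) \<noteq> 0"
proof (rule ccontr)
  assume "\<not> ?thesis"
  then have vanish: "det (A + X ** C) = 0" if "persym X" for X
    using that by blast
  \<comment> \<open>\<open>M i j\<close> is the minor of the first two columns of the block matrix
    formed by row i of A and row j of C.\<close>
  define M where "M i j = A$i$1 * C$j$2 - A$i$2 * C$j$1" for i j
  have mat: "persym (mat 1 :: 'a^2^2)" "persym (- mat 1 :: 'a^2^2)"
    by (simp_all add: persym_def mat_def)
  have "det A = 0"
    using vanish[of 0] by (simp add: persym_def)
  moreover have "det A - M 2 2 = 0"
    using vanish[of "mat2 0 1 0 0"]
    by (simp add: persym_def det_2 matrix_matrix_mult_def sum_2 M_def algebra_simps)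
  moreover have "det A + M 1 1 = 0"
    using vanish[of "mat2 0 0 1 0"]
    by (simp add: persym_def det_2 matrix_matrix_mult_def sum_2 M_def algebra_simps)
  moreover have "det A + det C + (M 1 2 - M 2 1) = 0"
    using vanish[OF mat(1)] by (simp add: det_2 M_def algebra_simps)
  moreover have "det A + det C - (M 1 2 - M 2 1) = 0"
    using vanish[OF mat(2)] by (simp add: det_2 M_def algebra_simps)
  moreover have "M 1 2 + M 2 1 = 0"
    using sp by (simp add: blk_mem_sp4 M_def algebra_simps)
  ultimately have zero: "det A = 0" "M 1 1 = 0" "M 2 2 = 0" "det C = 0" "M 1 2 = 0" "M 2 1 = 0"
    by (simp_all add: add_eq_0_iff)
  obtain h where "h ** blk A B C D = mat 1"
    using sp4_left_inverse[OF sp] .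
  moreover obtain P Q R S where "h = blk P Q R S"
    by (rule blk_cases)
  ultimately have "P ** A + Q ** C = mat 1"
    by (simp add: blk_mult mat_eq_blk blk_eq_iff)
  then have "1 = det (P ** A + Q ** C)"
    by simp
  \<comment> \<open>Cauchy-Binet for the first two rows of h and the first two columns of the given
    matrix.\<close>
  also have "\<dots> = det P * det A + det Q * det C
      + (P$1$1 * Q$2$1 - P$2$1 * Q$1$1) * M 1 1 + (P$1$1 * Q$2$2 - P$2$1 * Q$1$2) * M 1 2
      + (P$1$2 * Q$2$1 - P$2$2 * Q$1$1) * M 2 1 + (P$1$2 * Q$2$2 - P$2$2 * Q$1$2) * M 2 2"
    by (simp add: det_2 matrix_matrix_mult_def sum_2 M_def algebra_simps)
  finally show False
    by (simp add: zero)
qed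

text \<open>For invertible A it exhibits A = T^(-1) (T A) as a product of two persymmetric matrices,
  and Weyl elements produce the Levi elements with persymmetric blocks.\<close>

lemma persym_factor:
  fixes A :: "'a::field^2^2"
  obtains T where "persym T" "persym (T ** A)" "det T \<noteq> 0"
proof -
  define a b c d where "a = A$1$1" and "b = A$1$2" and "c = A$2$1" and "d = A$2$2"
  \<comment> \<open>For T with diagonal entries p and off-diagonal entries q, r, persymmetry of T A
    is the linear condition p (a - d) + q c = r b. Each case picks a solution with p^2 - q r
    nonzero.\<close>
  define T where "T = (if b \<noteq> 0 \<and> c \<noteq> 0 then mat2 0 b c 0 else if b \<noteq> 0 then mat2 b 0 (a - d) b
     else if c \<noteq> 0 then mat2 c (d - a) 0 c else mat2 0 1 1 0)"
  show thesis
  proof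
    show "persym T" "persym (T ** A)" "det T \<noteq> 0"
      by (auto simp: T_def persym_def det_mat2 matrix_matrix_mult_def sum_2 a_def b_def c_def d_def algebra_simps)
  qed
qed

lemma persym_inverse:
  fixes X :: "'a::field^2^2"
  assumes "det X \<noteq> 0"
  obtains Y where "X ** Y = mat 1" "Y ** X = mat 1" "det Y \<noteq> 0" "persym X \<Longrightarrow> persym Y"
proof -
  define Y where "Y = mat2 (X$2$2 / det X) (- X$1$2 / det X) (- X$2$1 / det X) (X$1$1 / det X)"
  have "(X$1$1 * X$2$2 - X$1$2 * X$2$1) / det X = 1"
    using assms by (simp add: det_2)
  then have "X ** Y = mat 1" "Y ** X = mat 1"
    by (simp_all add: mat2_eq_iff Y_def matrix_matrix_mult_def sum_2 mat_def diff_divide_distrib mult.commute)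
  moreover from this have "det X * det Y = 1"
    by (metis det_I det_mul)
  then have "det Y \<noteq> 0"
    by auto
  moreover have "persym X \<Longrightarrow> persym Y"
    by (simp add: persym_def Y_def)
  ultimately show thesis
    using that by blast
qed

text \<open>Products of Weyl elements give the Levi subgroup, and a block LU decomposition then
  covers all elements with invertible upper left block. \<open>sp4_make_invertible\<close> moves
  every other element into this case by an upper unipotent.\<close>

lemma sp4_generated:
  fixes H :: "('a::field_char_0^4^4) set"
  assumes mult: "\<And>g h. g \<in> H \<Longrightarrow> h \<in> H \<Longrightarrow> g ** h \<in> H"
    and upper: "\<And>X. persym X \<Longrightarrow> upper X \<in> H"
    and lower: "\<And>X. persym X \<Longrightarrow> lower X \<in> H"
    and g: "g \<in> sp4"
  shows "g \<in> H"
proof -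
  \<comment> \<open>Keeping symplecticity with membership lets the symplectic relations determine
    the lower right blocks, which are not tracked explicitly.\<close>
  define H' where "H' = H \<inter> sp4"
  have mult': "g ** h \<in> H'" if "g \<in> H'" "h \<in> H'" for g h
    using that mult sp4_mult by (auto simp: H'_def)
  have upper': "upper X \<in> H'" and lower': "lower X \<in> H'" if "persym X" for X
    using that upper lower by (simp_all add: H'_def upper_in_sp4 lower_in_sp4)
  have sp_1: "persym B \<and> D = mat 1" if "blk (mat 1) B 0 D \<in> sp4" for B D :: "'a^2^2"
    using that by (auto simp: blk_mem_sp4 persym_def mat_def mat2_eq_iff)
  have levi_persym: "blk P 0 0 Q \<in> H'"
    if PQ: "P ** Q = mat 1" "Q ** P = mat 1" "persym P" "persym Q" for P Q
  proof -
    have "upper P ** lower (- Q) ** upper P \<in> H'"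
      using PQ by (intro mult' upper' lower') (auto simp: persym_def)
    then have "blk 0 P (- Q) 0 \<in> H'"
      using PQ by (simp add: weyl_element)
    moreover have "upper (- mat 1) ** lower (- (- mat 1)) ** upper (- mat 1) \<in> H'"
      by (intro mult' upper' lower') (auto simp: persym_def mat_def)
    then have "blk 0 (- mat 1) (mat 1) 0 \<in> H'"
      by (subst (asm) weyl_element) auto
    ultimately have "blk 0 P (- Q) 0 ** blk 0 (- mat 1) (mat 1) 0 \<in> H'"
      by (rule mult')
    then show ?thesis
      by (simp add: blk_mult)
  qed
  have levi: "\<exists>D. blk A 0 0 D \<in> H'" if A: "det A \<noteq> 0" for A
  proof -
    obtain T where T: "persym T" "persym (T ** A)" "det T \<noteq> 0"
      by (rule persym_factor)
    obtain U where U: "T ** U = mat 1" "U ** T = mat 1" "persym U"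
      using persym_inverse[OF T(3)] T(1) by metis
    have "det (T ** A) \<noteq> 0"
      using T(3) A by (simp add: det_mul)
    then obtain V where V: "T ** A ** V = mat 1" "V ** (T ** A) = mat 1" "persym V"
      using persym_inverse T(2) by metis
    have "blk U 0 0 T ** blk (T ** A) 0 0 V \<in> H'"
      using T U V by (intro mult' levi_persym)
    then have "blk A 0 0 (T ** V) \<in> H'"
      by (simp add: blk_mult matrix_mul_assoc U)
    then show ?thesis ..
  qed
  \<comment> \<open>Block LU decomposition. Multiplying on the right by the Levi element of A' makes
    the upper left block 1; the symplectic relations then make C A' and B E' persymmetric and force
    the remaining block, so the quotient is a lower times an upper unipotent.\<close>
  have nonsing: "blk A B C D \<in> H'" if A: "det A \<noteq> 0" and sp: "blk A B C D \<in> sp4" for A B C D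
  proof -
    obtain A' where A': "A ** A' = mat 1" "A' ** A = mat 1" "det A' \<noteq> 0"
      using persym_inverse[OF A] by metis
    obtain E E' where E: "blk A 0 0 E \<in> H'" and E': "blk A' 0 0 E' \<in> H'"
      using levi A A'(3) by metis
    have "blk A' 0 0 E' ** blk A 0 0 E \<in> sp4"
      using mult'[OF E' E] by (simp add: H'_def)
    then have one: "E' ** E = mat 1"
      using sp_1 by (simp add: blk_mult A')
    have sp1: "blk (mat 1) (B ** E') (C ** A') (D ** E') \<in> sp4"
      using sp4_mult[OF sp, of "blk A' 0 0 E'"] E' by (simp add: H'_def blk_mult A')
    then have C': "persym (C ** A')"
      by (simp add: blk_mem_sp4 persym_def mat_def)
    then have "lower (- (C ** A')) \<in> H'"
      by (intro lower') (simp add: persym_def)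
    then have "lower (- (C ** A')) ** blk (mat 1) (B ** E') (C ** A') (D ** E') \<in> sp4"
      using sp1 sp4_mult by (auto simp: H'_def)
    then have "persym (B ** E')" "D ** E' - C ** A' ** (B ** E') = mat 1"
      using sp_1 by (auto simp: lower_def blk_mult)
    then have "lower (C ** A') ** upper (B ** E') ** blk A 0 0 E \<in> H'"
      and D: "D ** E' = C ** A' ** (B ** E') + mat 1"
      using C' E by (auto intro!: mult' upper' lower' simp: algebra_simps)
    moreover have "lower (C ** A') ** upper (B ** E') = blk (mat 1) (B ** E') (C ** A') (D ** E')"
      by (simp add: lower_def upper_def blk_mult D)
    ultimately have "blk (mat 1 ** A) (B ** E' ** E) (C ** A' ** A) (D ** E' ** E) \<in> H'"
      by (simp add: blk_mult)
    then show ?thesis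
      by (simp add: A' one flip: matrix_mul_assoc)
  qed
  obtain A B C D where g_eq: "g = blk A B C D"
    by (rule blk_cases)
  obtain X where X: "persym X" "det (A + X ** C) \<noteq> 0"
    using sp4_make_invertible g g_eq by metis
  have "upper X ** g \<in> sp4"
    using upper'[OF X(1)] g sp4_mult by (auto simp: H'_def)
  then have "upper X ** g \<in> H'"
    using nonsing X(2) by (simp add: g_eq upper_def blk_mult)
  moreover have "upper (- X) \<in> H'"
    using X(1) by (intro upper') (simp add: persym_def)
  ultimately have "upper (- X) ** (upper X ** g) \<in> H'"
    by (rule mult'[rotated])
  moreover have "upper (- X) ** (upper X ** g) = g"
    by (simp add: matrix_mul_assoc upper_mult) (simp add: upper_def flip: mat_eq_blk)
  ultimately show ?thesis
    by (simp add: H'_def)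
qed

section \<open>Generation by two root subgroups of different levels\<close>

text \<open>The matrix is t \<sigma> \<iota>. Since \<iota> x is the conjugate of x times \<iota>,
  multiplication by x on both sides amounts to scaling by the norm of x.\<close>

lemma iota_part_conj:
  assumes "x \<in> carrier (quad_field e)"
  shows "x ** mat2 0 (- (e * t)) t 0 ** x = mat2 0 (- (e * (t * det x))) (t * det x) 0"
proof -
  obtain a b where "x = quad_elt e a b"
    using assms by (auto simp: carrier_quad_field)
  then show ?thesis
    by (simp add: det_quad_elt) (simp add: quad_elt_def mat2_mult mat2_eq_iff algebra_simps)
qed

lemma persym_quad_field: "x \<in> carrier (quad_field e) \<Longrightarrow> persym x"
  by (auto simp: carrier_quad_field persym_def quad_elt_def)

text \<open>Reflection about the antidiagonal reverses products and fixes E elementwise, so it fixes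
  x Y x together with Y.\<close>

lemma persym_conj:
  assumes "x \<in> carrier (quad_field e)" "persym Y"
  shows "persym (x ** Y ** x)"
proof -
  obtain a b where "x = quad_elt e a b"
    using assms by (auto simp: carrier_quad_field)
  then show ?thesis
    using assms(2) by (simp add: persym_def quad_elt_def matrix_matrix_mult_def sum_2 algebra_simps)
qed

text \<open>The three-dimensional space of persymmetric matrices is E plus the line F \<sigma>
  \<iota>. On these two summands the torus acts by multiplication with squares in E and with norms,
  so they can be expanded separately.\<close>

lemma persym_decompose:
  fixes e :: "'a::field_char_0"
  assumes "e \<noteq> 0" "persym X"
  obtains z t where "z \<in> carrier (quad_field e)" "X = z + mat2 0 (- (e * t)) t 0"
proof
  define z where "z = quad_elt e (X$1$1) ((X$2$1 + X$1$2 / e) / 2)"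
  show "z \<in> carrier (quad_field e)"
    by (simp add: z_def)
  show "X = z + mat2 0 (- (e * ((X$2$1 - X$1$2 / e) / 2))) ((X$2$1 - X$1$2 / e) / 2) 0"
    using assms by (simp add: z_def quad_elt_def mat2_eq_iff persym_def field_simps)
qed

text \<open>Two Weyl elements of different levels differ by the torus element \<open>diag(\<rho>\<^sup>-\<^sup>1, \<rho>)\<close> of
  \<open>SL\<^sub>2(E)\<close>, and conjugation by it expands the given unipotent elements to all of them.\<close>

lemma sp4_generated_by_levels:
  fixes e :: "'a::nonarch_local_field" and H :: "('a^4^4) set"
  assumes nsq: "\<nexists>x. e = x\<^sup>2"
    and \<rho>: "\<rho> \<in> carrier (quad_field e)" "vabs (det \<rho>) < 1" "det \<rho> \<noteq> 0"
    and y: "y \<in> carrier (quad_field e)"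
    and x: "x \<in> carrier (quad_field e)" "x ** (y ** \<rho>) = mat 1"
    and d: "d \<noteq> 0"
    and mult: "\<And>g h. g \<in> H \<Longrightarrow> h \<in> H \<Longrightarrow> g ** h \<in> H"
    and upper_E: "\<And>a. a \<in> carrier (quad_int_ring e) \<Longrightarrow> upper (x ** a) \<in> H"
    and upper_iota: "\<And>t. vabs t \<le> 1 \<Longrightarrow> upper (mat2 0 (- (e * (t / d))) (t / d) 0) \<in> H"
    and lower_E: "\<And>a. a \<in> carrier (quad_int_ring e) \<Longrightarrow> lower (y ** a) \<in> H"
  shows "sp4 \<subseteq> H"
proof -
  let ?E = "carrier (quad_field e)"
  \<comment> \<open>In the application x is a generator of the upper lattice of level m and y of the
    lower lattice of level m - 1. Then \<open>y'\<close> is inverse to \<open>x\<close> and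
    \<open>x'\<close> is inverse to \<open>y\<close>, which gives a Weyl element for each of the two
    levels.\<close>
  define x' y' where "x' = x ** \<rho>" and "y' = y ** \<rho>"
  note int = carrier_quad_int_ring[OF nsq]
  have E: "x' \<in> ?E" "y' \<in> ?E"
    using x y \<rho> by (auto simp: x'_def y'_def)
  note comm = quad_field_commute[OF y \<rho>(1)] quad_field_commute[OF x(1) E(2)]
    quad_field_commute[OF y E(1)] quad_field_commute[OF \<rho>(1) E(2)] quad_field_commute[OF x(1) y]
  have inv: "x ** y' = mat 1" "y' ** x = mat 1" "x' ** y = mat 1" "y ** x' = mat 1"
  proof -
    show 1: "x ** y' = mat 1"
      using x(2) by (simp add: y'_def)
    then show "y' ** x = mat 1"
      using comm(2) by simp
    have "x' ** y = x ** y'"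
      unfolding x'_def y'_def comm(1) by (rule matrix_mul_assoc[symmetric])
    then show "x' ** y = mat 1"
      using 1 by simp
    then show "y ** x' = mat 1"
      using comm(3) by simp
  qed
  have O: "mat 1 \<in> carrier (quad_int_ring e)" "- mat 1 \<in> carrier (quad_int_ring e)"
    "\<rho> \<in> carrier (quad_int_ring e)" "- \<rho> \<in> carrier (quad_int_ring e)"
    using \<rho> by (auto simp: int det_uminus_2)
  have H: "upper x \<in> H" "upper (- x) \<in> H" "upper x' \<in> H" "upper (- x') \<in> H"
      "lower y \<in> H" "lower (- y) \<in> H" "lower y' \<in> H" "lower (- y') \<in> H"
    using upper_E[OF O(1)] upper_E[OF O(2)] upper_E[OF O(3)] upper_E[OF O(4)]
      lower_E[OF O(1)] lower_E[OF O(2)] lower_E[OF O(3)] lower_E[OF O(4)]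
    by (auto simp: x'_def y'_def)
  have weyl: "blk 0 x (- y') 0 \<in> H" "blk 0 (- x) y' 0 \<in> H"
      "blk 0 x' (- y) 0 \<in> H" "blk 0 (- x') y 0 \<in> H"
    using mult[OF mult[OF H(1,8)] H(1)] mult[OF mult[OF H(2,7)] H(2)]
      mult[OF mult[OF H(3,6)] H(3)] mult[OF mult[OF H(4,5)] H(4)]
      weyl_element[of x y'] weyl_element[of "- x" "- y'"] weyl_element[of x' y] weyl_element[of "- x'" "- y"]
    by (auto simp: inv)
  define \<rho>' where "\<rho>' = x ** y"
  have \<rho>': "\<rho>' ** \<rho> = mat 1" "\<rho> ** \<rho>' = mat 1"
  proof -
    show "\<rho>' ** \<rho> = mat 1"
      using inv(1) by (simp add: \<rho>'_def y'_def matrix_mul_assoc)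
    then show "\<rho> ** \<rho>' = mat 1"
      using quad_field_commute[OF quad_field_closed(1)[OF x(1) y] \<rho>(1)] by (simp add: \<rho>'_def)
  qed
  have "y' ** x' = \<rho>"
    by (simp add: x'_def matrix_mul_assoc inv)
  moreover have "x' ** y' = \<rho>"
  proof -
    have "x' ** y' = x ** (y' ** \<rho>)"
      unfolding x'_def comm(4)[symmetric] by (rule matrix_mul_assoc[symmetric])
    then show ?thesis
      by (simp add: matrix_mul_assoc inv)
  qed
  ultimately have torus: "blk \<rho>' 0 0 \<rho> \<in> H" "blk \<rho> 0 0 \<rho>' \<in> H"
    using mult[OF weyl(1,4)] mult[OF weyl(3,2)] comm(5) by (simp_all add: blk_mult \<rho>'_def)
  have cancel: "A ** \<rho> ** \<rho>' = A" "A ** x ** y' = A" for A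
    by (simp_all add: \<rho>' inv flip: matrix_mul_assoc)
  have conj: "upper X \<in> H" if "upper (\<rho> ** X ** \<rho>) \<in> H" for X
  proof -
    have "blk \<rho>' 0 0 \<rho> ** upper (\<rho> ** X ** \<rho>) ** blk \<rho> 0 0 \<rho>' \<in> H"
      by (intro mult torus that)
    also have "blk \<rho>' 0 0 \<rho> ** upper (\<rho> ** X ** \<rho>) ** blk \<rho> 0 0 \<rho>' = upper ((\<rho>' ** \<rho>) ** X ** (\<rho> ** \<rho>'))"
      by (simp add: upper_def blk_mult blk_eq_iff \<rho>' cancel matrix_mul_assoc)
    finally show ?thesis
      by (simp add: \<rho>')
  qed
  have small: "\<exists>n. a * vabs (det \<rho>) ^ n \<le> 1" for a
  proof (cases "a \<le> 0")
    case True
    then have "a * vabs (det \<rho>) ^ 0 \<le> 1"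
      by simp
    then show ?thesis ..
  next
    case False
    then obtain n where "vabs (det \<rho>) ^ n < 1 / a"
      using real_arch_pow_inv[of "1 / a" "vabs (det \<rho>)"] \<rho>(2) by auto
    then have "a * vabs (det \<rho>) ^ n \<le> 1"
      using False by (simp add: field_simps)
    then show ?thesis ..
  qed
  have upper_z: "upper z \<in> H" if "z \<in> ?E" for z
  proof -
    have "upper z \<in> H" if "z \<in> ?E" "vabs (det (y' ** z)) * vabs (det \<rho>) ^ n \<le> 1" for z n
      using that
    proof (induction n arbitrary: z)
      case 0
      then have "upper (x ** (y' ** z)) \<in> H"
        using E by (intro upper_E) (auto simp: int)
      then show ?case
        by (simp add: matrix_mul_assoc inv)
    next
      case (Suc n)
      \<comment> \<open>Passing from z to \<rho> z \<rho> contributes the square of the norm of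
        \<rho>, while the exponent drops by only one. The surplus factor is at most 1.\<close>
      have "vabs (det \<rho>) * (vabs (det (y' ** z)) * vabs (det \<rho>) ^ Suc n) \<le> 1 * 1"
        using Suc.prems \<rho>(2) by (intro mult_mono) auto
      also have "vabs (det \<rho>) * (vabs (det (y' ** z)) * vabs (det \<rho>) ^ Suc n) =
          vabs (det (y' ** (\<rho> ** z ** \<rho>))) * vabs (det \<rho>) ^ n"
        by (simp add: det_mul vabs_mult)
      finally have "upper (\<rho> ** z ** \<rho>) \<in> H"
        using Suc.prems(1) \<rho>(1) by (intro Suc.IH) auto
      then show ?case
        by (rule conj)
    qed
    moreover obtain n where "vabs (det (y' ** z)) * vabs (det \<rho>) ^ n \<le> 1"
      using small by blast
    ultimately show ?thesis
      using \<open>z \<in> ?E\<close> by blast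
  qed
  have upper_t: "upper (mat2 0 (- (e * t)) t 0) \<in> H" for t
  proof -
    have "upper (mat2 0 (- (e * t)) t 0) \<in> H" if "vabs (d * t) * vabs (det \<rho>) ^ n \<le> 1" for t n
      using that
    proof (induction n arbitrary: t)
      case 0
      then show ?case
        using upper_iota[of "d * t"] d by simp
    next
      case (Suc n)
      then have "upper (mat2 0 (- (e * (t * det \<rho>))) (t * det \<rho>) 0) \<in> H"
        by (intro Suc.IH) (simp add: vabs_mult algebra_simps)
      then show ?case
        using conj iota_part_conj[OF \<rho>(1)] by simp
    qed
    moreover obtain n where "vabs (d * t) * vabs (det \<rho>) ^ n \<le> 1"
      using small by blast
    ultimately show ?thesis
      by blast
  qed
  have "e \<noteq> 0"
    using nsq by auto
  have upper_all: "upper X \<in> H" if "persym X" for X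
  proof -
    obtain z t where "z \<in> ?E" "X = z + mat2 0 (- (e * t)) t 0"
      using persym_decompose[OF \<open>e \<noteq> 0\<close> \<open>persym X\<close>] .
    then show ?thesis
      using mult[OF upper_z[of z] upper_t[of t]] by (simp add: upper_mult)
  qed
  \<comment> \<open>The two Weyl elements used are inverse to each other, and conjugation by them
    exchanges the upper and lower unipotents.\<close>
  have lower_all: "lower Y \<in> H" if "persym Y" for Y
  proof -
    have "persym (- (x ** Y ** x))"
      using persym_conj[OF x(1) that] by (simp add: persym_def)
    then have "blk 0 x (- y') 0 ** upper (- (x ** Y ** x)) ** blk 0 (- x) y' 0 \<in> H"
      by (intro mult weyl upper_all)
    also have "blk 0 x (- y') 0 ** upper (- (x ** Y ** x)) ** blk 0 (- x) y' 0 =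
        lower ((y' ** x) ** Y ** (x ** y'))"
      by (simp add: upper_def lower_def blk_mult blk_eq_iff inv cancel matrix_mul_assoc)
    finally show ?thesis
      by (simp add: inv)
  qed
  show ?thesis
    using sp4_generated[of H] mult upper_all lower_all by blast
qed

section \<open>The similitude group\<close>

lemma mat_mult_nth:
  fixes A :: "'a::comm_ring_1^'n^'n"
  shows "(A ** mat c) $ i $ j = c * A $ i $ j" "(mat c ** A) $ i $ j = c * A $ i $ j"
proof -
  have "(\<Sum>k\<in>UNIV. A $ i $ k * (if k = j then c else 0)) = (\<Sum>k\<in>UNIV. if k = j then c * A $ i $ k else 0)"
    by (rule sum.cong) auto
  then show "(A ** mat c) $ i $ j = c * A $ i $ j"
    by (simp add: matrix_matrix_mult_def mat_def)
  have "(\<Sum>k\<in>UNIV. (if i = k then c else 0) * A $ k $ j) = (\<Sum>k\<in>UNIV. if i = k then c * A $ k $ j else 0)"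
    by (rule sum.cong) auto
  then show "(mat c ** A) $ i $ j = c * A $ i $ j"
    by (simp add: matrix_matrix_mult_def mat_def)
qed

lemma mat_mult_commute: "A ** mat c = mat c ** (A :: 'a::comm_ring_1^'n^'n)"
  by (simp add: vec_eq_iff mat_mult_nth)

lemma mat_mult_mat: "mat a ** mat b = (mat (a * b) :: 'a::comm_ring_1^'n^'n)"
  by (simp add: vec_eq_iff mat_mult_nth) (simp add: mat_def)

lemma similitude_eqI:
  assumes "transpose g ** J4 ** g = mat \<mu> ** (J4 :: 'a::field^4^4)"
  shows "similitude g = \<mu>"
  unfolding similitude_def
proof (rule the_equality)
  fix \<nu> assume "transpose g ** J4 ** g = mat \<nu> ** J4"
  \<comment> \<open>The entry of J4 at (3, 2) is 1, so it reads off the multiplier.\<close>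
  with assms have "(mat \<mu> ** J4) $ 3 $ 2 = (mat \<nu> ** J4 :: 'a^4^4) $ 3 $ 2"
    by simp
  then show "\<nu> = \<mu>"
    by (simp add: mat_eq_blk J4_eq_blk blk_mult) (simp add: mat2_simps)
qed fact

lemma similitude_mult:
  assumes "transpose g ** J4 ** g = mat \<mu> ** (J4 :: 'a::field^4^4)" "transpose h ** J4 ** h = mat \<nu> ** J4"
  shows "transpose (g ** h) ** J4 ** (g ** h) = mat (\<mu> * \<nu>) ** J4"
proof -
  have "transpose (g ** h) ** J4 ** (g ** h) = transpose h ** (transpose g ** J4 ** g) ** h"
    by (simp add: matrix_transpose_mul matrix_mul_assoc)
  also have "\<dots> = mat \<mu> ** (transpose h ** J4 ** h)"
    by (simp add: assms(1) matrix_mul_assoc mat_mult_commute)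
  finally show ?thesis
    by (simp add: assms(2) matrix_mul_assoc mat_mult_mat)
qed

lemma carrier_GSp4: "g \<in> carrier GSp4 \<longleftrightarrow> (\<exists>\<mu>. \<mu> \<noteq> 0 \<and> transpose g ** J4 ** g = mat \<mu> ** J4)"
  by (simp add: GSp4_def)

lemma GSp4_mult [simp]: "g \<otimes>\<^bsub>GSp4\<^esub> h = g ** h"
  by (simp add: GSp4_def)

lemma GSp4_closed: "g \<in> carrier GSp4 \<Longrightarrow> h \<in> carrier GSp4 \<Longrightarrow> g ** h \<in> carrier GSp4"
proof -
  assume "g \<in> carrier GSp4" "h \<in> carrier GSp4"
  then obtain \<mu> \<nu> where "\<mu> \<noteq> 0" "transpose g ** J4 ** g = mat \<mu> ** J4"
      "\<nu> \<noteq> 0" "transpose h ** J4 ** h = mat \<nu> ** J4"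
    unfolding carrier_GSp4 by blast
  then have "\<mu> * \<nu> \<noteq> 0 \<and> transpose (g ** h) ** J4 ** (g ** h) = mat (\<mu> * \<nu>) ** J4"
    using similitude_mult by auto
  then show ?thesis
    unfolding carrier_GSp4 by blast
qed

lemma sp4_similitude: "g \<in> sp4 \<Longrightarrow> transpose g ** J4 ** g = mat 1 ** J4"
  by (simp add: sp4_def)

lemma sp4_subset_GSp4: "(sp4 :: ('a::field^4^4) set) \<subseteq> carrier GSp4"
proof
  fix g :: "'a^4^4" assume "g \<in> sp4"
  then have "1 \<noteq> (0::'a) \<and> transpose g ** J4 ** g = mat 1 ** J4"
    by (intro conjI sp4_similitude) simp_all
  then show "g \<in> carrier GSp4"
    unfolding carrier_GSp4 by blast
qed

lemma similitude_sp4: "g \<in> sp4 \<Longrightarrow> similitude g = (1 :: 'a::field)"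
  by (intro similitude_eqI sp4_similitude)

text \<open>A multiplicative section of the similitude character, which splits every element of
  GSp_4 into a diagonal and a symplectic factor.\<close>

definition simil_diag :: "'a::field \<Rightarrow> 'a^4^4" where
  "simil_diag \<mu> = blk (mat 1) 0 0 (mat \<mu>)"

lemma transpose_zero [simp]: "transpose 0 = (0 :: 'a::zero^'n^'m)"
  by (simp add: vec_eq_iff transpose_def)

lemma simil_diag_similitude: "transpose (simil_diag \<mu>) ** J4 ** simil_diag \<mu> = mat \<mu> ** J4"
  by (simp add: simil_diag_def transpose_blk J4_eq_blk mat_eq_blk blk_mult blk_eq_iff)
    (simp add: mat2_simps)

lemma simil_diag_mem: "\<mu> \<noteq> 0 \<Longrightarrow> simil_diag \<mu> \<in> carrier GSp4"
  unfolding carrier_GSp4 using simil_diag_similitude by blast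

lemma simil_diag_mult: "simil_diag a ** simil_diag b = simil_diag (a * b)"
  by (simp add: simil_diag_def blk_mult mat_mult_mat)

lemma simil_diag_1: "simil_diag 1 = mat 1"
  by (simp add: simil_diag_def mat_eq_blk)

lemma GSp4_factor:
  fixes g :: "'a::field^4^4"
  assumes "g \<in> carrier GSp4"
  obtains \<mu> s where "\<mu> \<noteq> 0" "s \<in> sp4" "g = simil_diag \<mu> ** s"
proof -
  obtain \<mu> where \<mu>: "\<mu> \<noteq> 0" "transpose g ** J4 ** g = mat \<mu> ** J4"
    using assms unfolding carrier_GSp4 by blast
  have "simil_diag (inverse \<mu>) ** g \<in> sp4"
    using similitude_mult[OF simil_diag_similitude \<mu>(2), of "inverse \<mu>"] \<mu>(1) by (simp add: sp4_def)
  moreover have "g = simil_diag \<mu> ** (simil_diag (inverse \<mu>) ** g)"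
    using \<mu>(1) by (simp add: matrix_mul_assoc simil_diag_mult simil_diag_1)
  ultimately show thesis
    using that \<mu>(1) by blast
qed

section \<open>Elements of the paramodular groups\<close>

lemma delta_nonzero: "delta e \<noteq> 0"
  by (simp add: delta_def)

lemma blk_mem_paramodular:
  "blk A B C D \<in> paramodular e \<rho> m \<longleftrightarrow> blk A B C D \<in> carrier GSp4 \<and>
     similitude (blk A B C D) \<in> int_units \<and> A \<in> R_level e \<rho> m \<and> D \<in> R_level e \<rho> m \<and>
     B \<in> {mat (inverse (delta e)) ** (inv\<^bsub>quad_field e\<^esub> (\<rho> [^]\<^bsub>quad_field e\<^esub> m)) ** r | r. r \<in> R_level e \<rho> m} \<and>
     C \<in> {mat (delta e) ** (\<rho> [^]\<^bsub>quad_field e\<^esub> m) ** r | r. r \<in> R_level e \<rho> m}"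
  unfolding paramodular_def by (simp add: mat2_collapse)

context
  fixes e :: "'a::nonarch_local_field"
  assumes nsq: "\<nexists>x. e = x\<^sup>2"
begin

lemma mat_in_quad_int_ring: "vabs c \<le> 1 \<Longrightarrow> mat c \<in> carrier (quad_int_ring e)"
  by (simp add: carrier_quad_int_ring[OF nsq] det_mat2x2 vabs_mult_le_1)

lemma zero_in_quad_int_ring: "0 \<in> carrier (quad_int_ring e)"
  by (simp add: carrier_quad_int_ring[OF nsq] det_2)

lemma quad_int_ring_subset_R_level: "carrier (quad_int_ring e) \<subseteq> R_level e \<rho> m"
proof
  fix x assume x: "x \<in> carrier (quad_int_ring e)"
  have "0 + 0 ** iota \<in> R_order e"
    unfolding R_order_def using zero_in_quad_int_ring by blast
  then have "x + (\<rho> [^]\<^bsub>quad_field e\<^esub> m) ** (0 + 0 ** iota) \<in> R_level e \<rho> m"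
    unfolding R_level_def using x by blast
  then show "x \<in> R_level e \<rho> m"
    by simp
qed

text \<open>In the upper right block the factor \<rho>^m cancels against \<rho>^(-m), so that block
  contains \<delta>^(-1) times the \<iota> part of the order at every level.\<close>

lemma iota_in_R_level:
  assumes x: "x \<in> carrier (quad_int_ring e)"
  shows "(\<rho> [^]\<^bsub>quad_field e\<^esub> m) ** (x ** iota) \<in> R_level e \<rho> m"
proof -
  have "0 + x ** iota \<in> R_order e"
    unfolding R_order_def using zero_in_quad_int_ring x by blast
  then have "0 + (\<rho> [^]\<^bsub>quad_field e\<^esub> m) ** (0 + x ** iota) \<in> R_level e \<rho> m"
    unfolding R_level_def using zero_in_quad_int_ring by blast
  then show ?thesis
    by simp
qed

lemma mat_in_R_level: "vabs c \<le> 1 \<Longrightarrow> mat c \<in> R_level e \<rho> m"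
  using mat_in_quad_int_ring quad_int_ring_subset_R_level by blast

lemma zero_in_R_level: "0 \<in> R_level e \<rho> m"
  using zero_in_quad_int_ring quad_int_ring_subset_R_level by blast

lemma upper_in_paramodular:
  assumes "persym X" "r \<in> R_level e \<rho> m"
    and "X = mat (inverse (delta e)) ** (inv\<^bsub>quad_field e\<^esub> (\<rho> [^]\<^bsub>quad_field e\<^esub> m)) ** r"
  shows "upper X \<in> paramodular e \<rho> m"
proof -
  have "mat (delta e) ** (\<rho> [^]\<^bsub>quad_field e\<^esub> m) ** 0 = 0"
    by simp
  then have "0 \<in> {mat (delta e) ** (\<rho> [^]\<^bsub>quad_field e\<^esub> m) ** r | r. r \<in> R_level e \<rho> m}"
    using zero_in_R_level by (metis (mono_tags, lifting) mem_Collect_eq)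
  moreover have "upper X \<in> sp4"
    using assms(1) by (rule upper_in_sp4)
  ultimately show ?thesis
    using assms(2,3) sp4_subset_GSp4 similitude_sp4[OF \<open>upper X \<in> sp4\<close>]
    unfolding upper_def blk_mem_paramodular by (auto simp: int_units_def mat_in_R_level)
qed

lemma lower_in_paramodular:
  assumes "persym X" "r \<in> R_level e \<rho> m" "X = mat (delta e) ** (\<rho> [^]\<^bsub>quad_field e\<^esub> m) ** r"
  shows "lower X \<in> paramodular e \<rho> m"
proof -
  have "mat (inverse (delta e)) ** (inv\<^bsub>quad_field e\<^esub> (\<rho> [^]\<^bsub>quad_field e\<^esub> m)) ** 0 = 0"
    by simp
  then have "0 \<in> {mat (inverse (delta e)) ** (inv\<^bsub>quad_field e\<^esub> (\<rho> [^]\<^bsub>quad_field e\<^esub> m)) ** r | r. r \<in> R_level e \<rho> m}"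
    using zero_in_R_level by (metis (mono_tags, lifting) mem_Collect_eq)
  moreover have "lower X \<in> sp4"
    using assms(1) by (rule lower_in_sp4)
  ultimately show ?thesis
    using assms(2,3) sp4_subset_GSp4 similitude_sp4[OF \<open>lower X \<in> sp4\<close>]
    unfolding lower_def blk_mem_paramodular by (auto simp: int_units_def mat_in_R_level)
qed

lemma simil_diag_in_paramodular:
  assumes "vabs \<mu> = 1"
  shows "simil_diag \<mu> \<in> paramodular e \<rho> m"
proof -
  have "mat (inverse (delta e)) ** (inv\<^bsub>quad_field e\<^esub> (\<rho> [^]\<^bsub>quad_field e\<^esub> m)) ** 0 = 0"
    "mat (delta e) ** (\<rho> [^]\<^bsub>quad_field e\<^esub> m) ** 0 = 0"
    by simp_all
  then have "0 \<in> {mat (inverse (delta e)) ** (inv\<^bsub>quad_field e\<^esub> (\<rho> [^]\<^bsub>quad_field e\<^esub> m)) ** r | r. r \<in> R_level e \<rho> m}"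
    "0 \<in> {mat (delta e) ** (\<rho> [^]\<^bsub>quad_field e\<^esub> m) ** r | r. r \<in> R_level e \<rho> m}"
    using zero_in_R_level by (metis (mono_tags, lifting) mem_Collect_eq)+
  moreover have "\<mu> \<noteq> 0"
    using assms by auto
  ultimately show ?thesis
    using simil_diag_mem[of \<mu>] similitude_eqI[OF simil_diag_similitude[of \<mu>]] assms
    unfolding simil_diag_def blk_mem_paramodular by (simp add: int_units_def mat_in_R_level)
qed

text \<open>The case x = \<delta>^(-1) \<rho>^(-(k+1)) and y = \<delta> \<rho>^k of
  \<open>sp4_generated_by_levels\<close>. The upper unipotents come from the top level. The lower
  ones lie in the groups of all levels j \<le> k because \<rho>^k = \<rho>^j \<rho>^(k-j). A
  combination of vectors of several lower levels is only known to be fixed by the intersection,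
  hence the form of \<open>below\<close>.\<close>

lemma sp4_fixed_by_levels:
  fixes H :: "('a^4^4) set"
  assumes e: "vabs e \<le> 1"
    and \<rho>: "\<rho> \<in> carrier (quad_field e)" "vabs (det \<rho>) < 1" "det \<rho> \<noteq> 0"
    and mult: "\<And>g h. g \<in> H \<Longrightarrow> h \<in> H \<Longrightarrow> g ** h \<in> H"
    and top: "paramodular e \<rho> (Suc k) \<subseteq> H"
    and below: "(\<Inter>j\<le>k. paramodular e \<rho> j) \<subseteq> H"
  shows "sp4 \<subseteq> H"
proof -
  let ?pow = "\<lambda>n::nat. \<rho> [^]\<^bsub>quad_field e\<^esub> n"
  note int = carrier_quad_int_ring[OF nsq]
  define P where "P = ?pow (Suc k)"
  have P: "P \<in> carrier (quad_field e)"
    unfolding P_def using \<rho>(1) by (rule quad_pow_closed)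
  have "det P = det \<rho> ^ Suc k"
    unfolding P_def by (rule det_quad_pow)
  then have "det P \<noteq> 0"
    using \<rho>(3) by simp
  obtain Q where Q: "Q \<in> carrier (quad_field e)" "P ** Q = mat 1" "Q ** P = mat 1"
      "inv\<^bsub>quad_field e\<^esub> P = Q"
    using quad_field_inverse[OF P \<open>det P \<noteq> 0\<close>] by metis
  define d where "d = delta e"
  have d: "d \<noteq> 0"
    by (simp add: d_def delta_nonzero)
  define x y where "x = mat (inverse d) ** Q" and "y = mat d ** ?pow k"
  have xE: "x \<in> carrier (quad_field e)" and yE: "y \<in> carrier (quad_field e)"
    using Q \<rho> by (auto simp: x_def y_def)
  have "x ** (y ** \<rho>) = mat (inverse d) ** (Q ** mat d) ** P"
    by (simp add: x_def y_def P_def matrix_mul_assoc)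
  also have "\<dots> = mat (inverse d * d) ** (Q ** P)"
    unfolding mat_mult_commute[of Q d] by (simp add: matrix_mul_assoc mat_mult_mat)
  finally have xy: "x ** (y ** \<rho>) = mat 1"
    using d Q by simp
  show ?thesis
  proof (rule sp4_generated_by_levels[OF nsq \<rho> yE xE xy d mult])
    fix a assume a: "a \<in> carrier (quad_int_ring e)"
    then have aE: "a \<in> carrier (quad_field e)"
      by (simp add: int)
    have "upper (x ** a) \<in> paramodular e \<rho> (Suc k)"
    proof (rule upper_in_paramodular)
      show "persym (x ** a)"
        using xE aE by (blast intro: persym_quad_field)
      show "a \<in> R_level e \<rho> (Suc k)"
        using a quad_int_ring_subset_R_level by blast
    qed (use Q in \<open>simp add: x_def d_def P_def\<close>)
    then show "upper (x ** a) \<in> H"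
      using top by blast
    have "lower (y ** a) \<in> paramodular e \<rho> j" if "j \<le> k" for j
    proof (rule lower_in_paramodular)
      show "persym (y ** a)"
        using yE aE by (blast intro: persym_quad_field)
      have "vabs (det (?pow (k - j))) \<le> 1"
        using \<rho>(2) by (simp add: det_quad_pow vabs_power power_le_one)
      then have "?pow (k - j) ** a \<in> carrier (quad_int_ring e)"
        using a \<rho>(1) by (auto simp: int det_mul vabs_mult_le_1)
      then show "?pow (k - j) ** a \<in> R_level e \<rho> j"
        using quad_int_ring_subset_R_level by blast
      have "?pow k = ?pow j ** ?pow (k - j)"
        using monoid.nat_pow_mult[OF monoid_quad_field \<rho>(1), of j "k - j"] that by simp
      then show "y ** a = mat (delta e) ** ?pow j ** (?pow (k - j) ** a)"
        by (simp add: y_def d_def matrix_mul_assoc)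
    qed
    then show "lower (y ** a) \<in> H"
      using below by blast
  next
    fix t :: 'a assume t: "vabs t \<le> 1"
    \<comment> \<open>This is t \<sigma>, of norm - e t^2, which is integral because e and t
      are.\<close>
    let ?s = "quad_elt e 0 t"
    have "vabs (t * t) \<le> 1" "vabs (e * (t * t)) \<le> 1"
      using t e by (auto intro: vabs_mult_le_1)
    then have s: "?s \<in> carrier (quad_int_ring e)"
      by (simp add: int det_quad_elt mult.assoc)
    have "upper (mat2 0 (- (e * (t / d))) (t / d) 0) \<in> paramodular e \<rho> (Suc k)"
    proof (rule upper_in_paramodular[OF _ iota_in_R_level[OF s]])
      show "persym (mat2 0 (- (e * (t / d))) (t / d) 0)"
        by (simp add: persym_def)
      have "mat (inverse d) ** Q ** (P ** (?s ** iota)) = mat (inverse d) ** (?s ** iota)"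
        by (metis Q(3) matrix_mul_assoc matrix_mul_lid)
      also have "\<dots> = mat2 0 (- (e * (t / d))) (t / d) 0"
        by (simp add: quad_elt_def iota_def mat2_simps field_simps)
      finally show "mat2 0 (- (e * (t / d))) (t / d) 0 = mat (inverse (delta e)) **
          inv\<^bsub>quad_field e\<^esub> ?pow (Suc k) ** (?pow (Suc k) ** (?s ** iota))"
        unfolding P_def[symmetric] d_def[symmetric] Q(4) by simp
    qed
    then show "upper (mat2 0 (- (e * (t / d))) (t / d) 0) \<in> H"
      using top by blast
  qed
qed

end

section \<open>Representations\<close>

context PGSp4_rep
begin

lemma rep_mult:
  assumes "g \<in> carrier GSp4" "h \<in> carrier GSp4"
  shows "\<pi> (g ** h) v = \<pi> g (\<pi> h v)"
proof -
  have "\<pi> (g \<otimes>\<^bsub>GSp4\<^esub> h) = \<pi> g \<otimes>\<^bsub>GL_on scl\<^esub> \<pi> h"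
    using hom_GL assms by (rule hom_mult)
  then show ?thesis
    by (simp add: GL_on_def)
qed

lemma rep_linear: "g \<in> carrier GSp4 \<Longrightarrow> Vector_Spaces.linear scl scl (\<pi> g)"
  using hom_in_carrier[OF hom_GL, of g] by (simp add: GL_on_def)

lemma rep_fixes_sum:
  assumes g: "g \<in> carrier GSp4" and fixed: "\<And>i. i \<in> I \<Longrightarrow> \<pi> g (v i) = v i"
  shows "\<pi> g (\<Sum>i\<in>I. scl (c i) (v i)) = (\<Sum>i\<in>I. scl (c i) (v i))"
proof -
  interpret L: Vector_Spaces.linear scl scl "\<pi> g"
    using g by (rule rep_linear)
  show ?thesis
    by (simp add: L.sum L.scale fixed)
qed

text \<open>Modulo the centre and \<open>Sp\<^sub>4\<close>, the group is \<open>F\<^sup>\<times>\<close> modulo squares; modulo units as well, only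
  the parity of the valuation of the similitude is left, so the orbit has at most two elements.\<close>

lemma fin_dim_if_sp4_fixed:
  assumes irred: irreducible_rep
    and v: "v \<noteq> 0" and sp: "\<And>g. g \<in> sp4 \<Longrightarrow> \<pi> g v = v"
    and units: "\<And>\<mu>. vabs \<mu> = 1 \<Longrightarrow> \<pi> (simil_diag \<mu>) v = v"
  shows "fin_dim UNIV"
proof -
  \<comment> \<open>The scalar \<nu> times the symplectic matrix diag(1/\<nu>, \<nu>) in blocks is
    \<open>simil_diag (\<nu> * \<nu>)\<close>, so square similitudes act on v through the centre and
    Sp_4.\<close>
  have square: "\<pi> (simil_diag (\<nu> * \<nu> * u)) v = v" if "\<nu> \<noteq> 0" "vabs u = 1" for \<nu> u
  proof -
    let ?s = "blk (mat (inverse \<nu>)) 0 0 (mat \<nu>) :: 'a^4^4"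
    have u: "simil_diag u \<in> carrier GSp4"
      using that(2) by (intro simil_diag_mem) auto
    have s: "?s \<in> sp4"
      using that(1) by (simp add: blk_mem_sp4 mat_def)
    have z: "mat \<nu> ** ?s = simil_diag (\<nu> * \<nu>)"
      using that(1) by (simp add: mat_eq_blk[of \<nu>] blk_mult mat_mult_mat simil_diag_def)
    have zc: "(mat \<nu> :: 'a^4^4) \<in> carrier GSp4"
      unfolding carrier_GSp4 using that(1)
      by (intro exI[of _ "\<nu> * \<nu>"]) (simp add: mat_mult_mat matrix_mul_assoc mat_mult_commute[of "mat \<nu> ** J4"])
    have "\<pi> (simil_diag (\<nu> * \<nu>) ** simil_diag u) v = \<pi> (mat \<nu> ** ?s) (\<pi> (simil_diag u) v)"
      unfolding z[symmetric] using zc s sp4_subset_GSp4 GSp4_closed u by (intro rep_mult) auto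
    also have "\<dots> = \<pi> (mat \<nu>) (\<pi> ?s v)"
      unfolding units[OF that(2)] using zc s sp4_subset_GSp4 by (intro rep_mult) auto
    also have "\<dots> = v"
      using sp[OF s] centre_trivial[OF that(1)] by simp
    finally show ?thesis
      by (simp add: simil_diag_mult)
  qed
  from vabs_discrete obtain w :: 'a
    where w: "0 < vabs w" "\<forall>x::'a. x \<noteq> 0 \<longrightarrow> (\<exists>n::int. vabs x = vabs w powi n)"
    by blast
  have "w \<noteq> 0"
    using w(1) by auto
  have vabs_powi: "vabs (w powi n) = vabs w powi n" for n :: int
    by (simp add: power_int_def vabs_power vabs_inverse)
  define v' where "v' = \<pi> (simil_diag w) v"
  have orbit: "\<pi> g v \<in> {v, v'}" if g: "g \<in> carrier GSp4" for g
  proof -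
    obtain \<mu> s where \<mu>: "\<mu> \<noteq> 0" and s: "s \<in> sp4" and g_eq: "g = simil_diag \<mu> ** s"
      using GSp4_factor[OF g] .
    have "\<pi> g v = \<pi> (simil_diag \<mu>) v"
      unfolding g_eq using rep_mult[OF simil_diag_mem[OF \<mu>], of s v] s sp4_subset_GSp4 sp by auto
    moreover obtain n :: int where n: "vabs \<mu> = vabs w powi n"
      using w(2) \<mu> by blast
    moreover have "\<pi> (simil_diag \<mu>) v \<in> {v, v'}"
    proof (cases "even n")
      case True
      then obtain j where j: "n = j + j"
        by (metis evenE mult_2)
      define \<nu> where "\<nu> = w powi j"
      define u where "u = \<mu> / (\<nu> * \<nu>)"
      have \<nu>: "\<nu> \<noteq> 0"
        using \<open>w \<noteq> 0\<close> by (simp add: \<nu>_def)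
      have "vabs \<mu> = vabs \<nu> * vabs \<nu>"
        unfolding n j \<nu>_def vabs_powi using \<open>w \<noteq> 0\<close> by (intro power_int_add) simp
      then have "vabs u = 1"
        using \<nu> by (simp add: u_def vabs_divide vabs_mult)
      moreover have "\<mu> = \<nu> * \<nu> * u"
        using \<nu> by (simp add: u_def)
      ultimately show ?thesis
        using square[OF \<nu>] by simp
    next
      case False
      then obtain j where j: "n = j + j + 1"
        by (metis oddE mult_2)
      define \<nu> where "\<nu> = w powi j"
      define u where "u = \<mu> / (w * (\<nu> * \<nu>))"
      have \<nu>: "\<nu> \<noteq> 0"
        using \<open>w \<noteq> 0\<close> by (simp add: \<nu>_def)
      have "vabs \<mu> = vabs w powi (j + j) * vabs w powi 1"
        unfolding n j using \<open>w \<noteq> 0\<close> by (intro power_int_add) simp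
      also have "vabs w powi (j + j) = vabs \<nu> * vabs \<nu>"
        unfolding \<nu>_def vabs_powi using \<open>w \<noteq> 0\<close> by (intro power_int_add) simp
      finally have u: "vabs u = 1"
        using \<nu> \<open>w \<noteq> 0\<close> by (simp add: u_def vabs_divide vabs_mult)
      then have nz: "\<nu> * \<nu> * u \<noteq> 0"
        using \<nu> by auto
      have "\<mu> = w * (\<nu> * \<nu> * u)"
        using \<nu> \<open>w \<noteq> 0\<close> by (simp add: u_def)
      then have "\<pi> (simil_diag \<mu>) v = \<pi> (simil_diag w) (\<pi> (simil_diag (\<nu> * \<nu> * u)) v)"
        using rep_mult[OF simil_diag_mem[OF \<open>w \<noteq> 0\<close>] simil_diag_mem[OF nz]]
        by (simp add: simil_diag_mult)
      then show ?thesis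
        using square[OF \<nu> u] by (simp add: v'_def)
    qed
    ultimately show ?thesis
      by simp
  qed
  define W where "W = span {v, v'}"
  have "\<pi> g ` W \<subseteq> W" if g: "g \<in> carrier GSp4" for g
  proof -
    interpret L: Vector_Spaces.linear scl scl "\<pi> g"
      using g by (rule rep_linear)
    \<comment> \<open>The vector \<open>v'\<close> lies in the orbit of v, so its translates are
      again among the two vectors, and their span is stable.\<close>
    have "\<pi> g v' = \<pi> (g ** simil_diag w) v"
      using rep_mult[OF g simil_diag_mem[OF \<open>w \<noteq> 0\<close>]] by (simp add: v'_def)
    then have "\<pi> g ` {v, v'} \<subseteq> {v, v'}"
      using orbit[OF g] orbit[OF GSp4_closed[OF g simil_diag_mem[OF \<open>w \<noteq> 0\<close>]]] by auto
    moreover have "\<pi> g ` W = span (\<pi> g ` {v, v'})"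
      unfolding W_def by (rule L.span_image[symmetric])
    ultimately show ?thesis
      unfolding W_def using span_mono by blast
  qed
  moreover have "subspace W"
    by (simp add: W_def)
  moreover have "v \<in> W"
    by (simp add: W_def span_base)
  ultimately have "W = UNIV"
    using irred v unfolding irreducible_rep_def by blast
  then show ?thesis
    unfolding fin_dim_def W_def by (intro exI[of _ "{v, v'}"]) simp
qed

end

section \<open>Linear independence across levels\<close>

theorem theorem4p5:
  fixes e :: "'a::nonarch_local_field"
    and \<rho> :: "'a^2^2"
    and scl :: "complex \<Rightarrow> 'v::ab_group_add \<Rightarrow> 'v"
    and \<pi> :: "'a^4^4 \<Rightarrow> 'v \<Rightarrow> 'v"
    and r :: nat
    and m :: "nat \<Rightarrow> nat"
    and v :: "nat \<Rightarrow> 'v"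
  assumes e: "e \<in> int_ring" "\<nexists>x. e = x\<^sup>2"
    and \<rho>: "\<rho> \<in> carrier (quad_int_ring e)"
      "maximalideal (PIdl\<^bsub>quad_int_ring e\<^esub> \<rho>) (quad_int_ring e)"
    and rep: "PGSp4_rep scl \<pi>"
    and irred: "PGSp4_rep.irreducible_rep scl \<pi>"
    and adm: "PGSp4_rep.admissible scl \<pi>"
    and inf_dim: "\<not> PGSp4_rep.fin_dim scl (UNIV :: 'v set)"
    and m: "inj_on m {1..r}"
    and v_nz: "\<And>i. i \<in> {1..r} \<Longrightarrow> v i \<noteq> 0"
    and v_inv: "\<And>i. i \<in> {1..r} \<Longrightarrow> v i \<in> PGSp4_rep.fixed_space \<pi> (paramodular e \<rho> (m i))"
  shows "\<forall>c :: nat \<Rightarrow> complex. (\<Sum>i=1..r. scl (c i) (v i)) = 0 \<longrightarrow> (\<forall>i\<in>{1..r}. c i = 0)"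
proof (intro allI impI, rule ccontr)
  interpret PGSp4_rep scl \<pi>
    by (rule rep)
  fix c :: "nat \<Rightarrow> complex"
  assume sum0: "(\<Sum>i=1..r. scl (c i) (v i)) = 0" and nontrivial: "\<not> (\<forall>i\<in>{1..r}. c i = 0)"
  define I where "I = {i \<in> {1..r}. c i \<noteq> 0}"
  have I: "finite I" "I \<noteq> {}"
    using nontrivial by (auto simp: I_def)
  then have "Max (m ` I) \<in> m ` I"
    by (intro Max_in) auto
  then obtain i where i: "i \<in> I" "m i = Max (m ` I)"
    by auto
  define K where "K = I - {i}"
  have less: "m j < m i" if "j \<in> K" for j
  proof -
    have "m j \<le> m i"
      unfolding i(2) using \<open>j \<in> K\<close> I(1) by (intro Max_ge) (auto simp: K_def)
    moreover have "m j \<noteq> m i"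
      using inj_onD[OF m, of j i] \<open>j \<in> K\<close> i(1) by (auto simp: K_def I_def)
    ultimately show ?thesis
      by simp
  qed
  have ir: "i \<in> {1..r}" "c i \<noteq> 0"
    using i(1) by (auto simp: I_def)
  have "(\<Sum>j\<in>I. scl (c j) (v j)) = (\<Sum>j=1..r. scl (c j) (v j))"
    by (rule sum.mono_neutral_left) (auto simp: I_def)
  then have "scl (c i) (v i) + (\<Sum>j\<in>K. scl (c j) (v j)) = 0"
    using sum0 sum.remove[OF I(1) i(1), of "\<lambda>j. scl (c j) (v j)"] by (simp add: K_def)
  then have "scl (c i) (v i) = - (\<Sum>j\<in>K. scl (c j) (v j))"
    by (simp add: eq_neg_iff_add_eq_0)
  then have "scl (inverse (c i)) (scl (c i) (v i)) = scl (inverse (c i)) (- (\<Sum>j\<in>K. scl (c j) (v j)))"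
    by simp
  then have v_eq: "v i = (\<Sum>j\<in>K. scl (- (inverse (c i) * c j)) (v j))"
    using ir(2) by (simp add: scale_sum_right sum_negf)
  have fixed: "\<pi> h (v j) = v j" if "j \<in> {1..r}" "h \<in> paramodular e \<rho> (m j)" for h j
    using v_inv[OF that(1)] that(2) by (simp add: fixed_space_def)
  have "v i \<noteq> 0"
    using v_nz ir by blast
  \<comment> \<open>At top level 0 no lower level could occur, so the relation would express v i as
    an empty sum. Hence there is a level just below m i.\<close>
  obtain k where k: "m i = Suc k"
  proof (cases "m i")
    case 0
    then have "K = {}"
      using less by auto
    then show ?thesis
      using v_eq \<open>v i \<noteq> 0\<close> by simp
  qed (use that in blast)
  \<comment> \<open>The stabilizer is cut down to GSp_4 because \<pi> is multiplicative only
    there.\<close>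
  define H where "H = {h \<in> carrier GSp4. \<pi> h (v i) = v i}"
  have "vabs e \<le> 1" "\<rho> \<in> carrier (quad_field e)"
    using e(1) \<rho>(1) by (simp_all add: int_ring_def carrier_quad_int_ring[OF e(2)])
  then have "sp4 \<subseteq> H"
  proof (rule sp4_fixed_by_levels[OF e(2) _ _ uniformizer_norm[OF e(2) \<rho>]])
    show "g ** h \<in> H" if "g \<in> H" "h \<in> H" for g h
      using that by (simp add: H_def rep_mult GSp4_closed)
    show "paramodular e \<rho> (Suc k) \<subseteq> H"
      using fixed[OF ir(1)] by (auto simp: H_def k paramodular_def)
    show "(\<Inter>j\<le>k. paramodular e \<rho> j) \<subseteq> H"
    proof
      fix h assume h: "h \<in> (\<Inter>j\<le>k. paramodular e \<rho> j)"
      then have "h \<in> carrier GSp4"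
        by (auto simp: paramodular_def)
      moreover have "\<pi> h (v j) = v j" if "j \<in> K" for j
        using that less[OF that] h by (intro fixed) (auto simp: K_def I_def k)
      ultimately have "\<pi> h (v i) = v i"
        unfolding v_eq by (rule rep_fixes_sum)
      then show "h \<in> H"
        using \<open>h \<in> carrier GSp4\<close> by (simp add: H_def)
    qed
  qed
  moreover have "\<pi> (simil_diag \<mu>) (v i) = v i" if "vabs \<mu> = 1" for \<mu>
    using fixed[OF ir(1)] simil_diag_in_paramodular[OF e(2) that] by blast
  ultimately have "fin_dim UNIV"
    using fin_dim_if_sp4_fixed[OF irred \<open>v i \<noteq> 0\<close>] by (auto simp: H_def)
  then show False
    using inf_dim by blast
qed

end
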